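(* Let $p\in(0,1)$ be fixed (independent of $n$). For almost all graphs $G$ in the Erdős–Rényi model $G_{n,p}$, the energies of the first multiple Zagreb matrix $\ln\prod_1(G)$ and the first modified multiple Zagreb matrix $\ln\prod_1^*(G)$ satisfy $$\mathscr{E}\Big(\ln\prod\nolimits_1(G)\Big)=(1+o(1))\frac{16}{3\pi}\sqrt{\frac{1-p}{p}}\cdot n^{1/2}\ln n,$$ $$\mathscr{E}\Big(\ln\prod\nolimits_1^*(G)\Big)=(1+o(1))\frac{8}{3\pi}\sqrt{p(1-p)}\cdot n^{3/2}\ln n.$$
   Context: $G_{n,p}$ is the model of random simple graphs on vertex set $\{1,\dots,n\}$ in which each edge is present independently with probability $p$; $d_i$ is the degree of vertex $i$ in $G=(V,E)$. $\ln\prod_1(G)$ is the name of the $n\times n$ matrix with $(i,j)$-entry $\frac{\ln d_i}{d_i}+\frac{\ln d_j}{d_j}$ if $ij\in E$ and $0$ otherwise. $\ln\prod_1^*(G)$ is the name of the $n\times n$ matrix with $(i,j)$-entry $\ln(d_i+d_j)$ if $ij\in E$ and $0$ otherwise. The energy of a real symmetric matrix $A$ with eigenvalues $\lambda_1,\dots,\lambda_n$ is $\mathscr{E}(A)=\sum_{i=1}^n|\lambda_i|$. "Almost all" means with probability tending to $1$ as $n\to\infty$; thus "for almost all graphs, $\mathscr{E}=(1+o(1))g(n)$" means that for every $\varepsilon>0$, $\Pr(|\mathscr{E}/g(n)-1|>\varepsilon)\to0$ as $n\to\infty$. *)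

theory Defs
  imports "HOL-Probability.Probability" "Jordan_Normal_Form.Char_Poly"
begin

text \<open>A simple graph on the vertex set \<open>{1..n}\<close> is represented by its edge set, a set of
  two-element subsets of \<open>{1..n}\<close>.\<close>

definition vertex_pairs :: "nat \<Rightarrow> nat set set" where
  "vertex_pairs n = {e. e \<subseteq> {1..n} \<and> card e = 2}"

definition gnp :: "nat \<Rightarrow> real \<Rightarrow> nat set set pmf" where
  "gnp n p = map_pmf (\<lambda>present. {e. present e})
               (Pi_pmf (vertex_pairs n) False (\<lambda>_. bernoulli_pmf p))"

definition degree_of :: "nat set set \<Rightarrow> nat \<Rightarrow> nat" where
  "degree_of E i = card {e \<in> E. i \<in> e}"

text \<open>Matrix indices start at \<open>0\<close>, vertices at \<open>1\<close>: row and column \<open>k\<close> belong to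
  vertex \<open>Suc k\<close>.\<close>

definition edge_weight_mat ::
    "nat \<Rightarrow> nat set set \<Rightarrow> (nat \<Rightarrow> nat \<Rightarrow> real) \<Rightarrow> real mat" where
  "edge_weight_mat n E w =
     Matrix.mat n n (\<lambda>(k, l). if {Suc k, Suc l} \<in> E then w (Suc k) (Suc l) else 0)"

definition first_multiple_Zagreb :: "nat \<Rightarrow> nat set set \<Rightarrow> real mat" where
  "first_multiple_Zagreb n E = edge_weight_mat n E
     (\<lambda>i j. ln (real (degree_of E i)) / real (degree_of E i)
          + ln (real (degree_of E j)) / real (degree_of E j))"

definition first_modified_multiple_Zagreb :: "nat \<Rightarrow> nat set set \<Rightarrow> real mat" where
  "first_modified_multiple_Zagreb n E = edge_weight_mat n E
     (\<lambda>i j. ln (real (degree_of E i) + real (degree_of E j)))"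

text \<open>The multiset of roots of the characteristic polynomial lists the eigenvalues with their
  multiplicities. It is meant for symmetric matrices: over the reals, the
  characteristic polynomial of any other matrix need not split.\<close>

definition energy :: "real mat \<Rightarrow> real" where
  "energy A = (\<Sum>x\<in>#proots (char_poly A). \<bar>x\<bar>)"

text \<open>For almost all graphs in \<open>gnp n p\<close>, \<open>X n G = (1 + o(1)) g n\<close>.\<close>

definition asymp_almost_all ::
    "real \<Rightarrow> (nat \<Rightarrow> nat set set \<Rightarrow> real) \<Rightarrow> (nat \<Rightarrow> real) \<Rightarrow> bool" where
  "asymp_almost_all p X g \<longleftrightarrow>
     (\<forall>\<epsilon>>0. (\<lambda>n. measure_pmf.prob (gnp n p) {E. \<bar>X n E / g n - 1\<bar> > \<epsilon>}) \<longlonglongrightarrow> 0)"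

end

theory Submission
  imports Defs "Jordan_Normal_Form.Spectral_Radius" "HOL-Real_Asymp.Real_Asymp"
begin

text \<open>With high probability every degree is close to \<open>n p\<close>, so on the edges of a random graph the two
weights are close to a constant: \<open>2 ln n / (n p)\<close> for the first matrix, \<open>ln n\<close> for the second. Hence
both matrices are, up to a small error, a multiple \<open>c\<close> of the adjacency matrix, and the adjacency
matrix is \<open>\<surd>n H + p (J - I)\<close> with \<open>J\<close> the all-ones matrix and \<open>H\<close> the centred adjacency matrix,
whose off-diagonal entries have mean \<open>0\<close> and variance \<open>p (1 - p) / n\<close>. The energy is the trace norm. It moves
by at most \<open>\<surd>n\<close> times the Frobenius norm of a perturbation, and only by \<open>O(n c)\<close> under the
perturbation \<open>c p (J - I)\<close>, whose large part has rank one (lemma \<open>energy_perturbation_le\<close>). Everything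
therefore reduces to \<open>energy H / n \<longlonglongrightarrow> 8 / (3 \<pi>) \<surd>(p (1 - p))\<close>, the first absolute moment of Wigner's
semicircle law of variance \<open>v = p (1 - p)\<close>.

The semicircle law enters through the resolvent. For an eigenvalue \<open>\<lambda>\<close> one has
\<open>\<bar>\<lambda>\<bar> = 2 / \<pi> \<cdot> \<integral>\<^sub>0\<^sup>\<infinity> \<lambda>\<^sup>2 / (\<lambda>\<^sup>2 + t\<^sup>2) dt\<close>, so the energy is an integral, over the positive imaginary
axis, of the normalised trace \<open>s\<close> of the resolvent \<open>G = (H - z)\<inverse>\<close> at \<open>z = \<i> t\<close>. For fixed \<open>t\<close> the
trace nearly satisfies \<open>1 + z s + v s\<^sup>2 = 0\<close>: by \<open>H G = I + z G\<close>, \<open>n (1 + z s)\<close> is the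
sum of \<open>h\<^sub>i\<^sub>j G\<^sub>j\<^sub>i\<close> over all \<open>i, j\<close>, and resampling the single edge \<open>ij\<close> turns the mean of \<open>h\<^sub>i\<^sub>j G\<^sub>j\<^sub>i\<close> into
a difference of two resolvents, which the resolvent identity evaluates as \<open>- v / n \<cdot> G\<^sub>i\<^sub>i G\<^sub>j\<^sub>j\<close> up to
lower order. The same computation, weighted with the conjugate of \<open>1 + z s + v s\<^sup>2\<close>, bounds the second
moment of this defect by \<open>O(n\<^sup>-\<^sup>1\<^sup>/\<^sup>2)\<close> (lemma \<open>expected_squared_defect_bound\<close>), which covers the
mean of \<open>s\<close> and its fluctuations at once. On the imaginary axis only one of the two roots has positive imaginary part,
and the two roots are well separated; hence \<open>s\<close> is close to the semicircle root in mean
(lemma \<open>semicircle_root_stability\<close>). The integrand is dominated by \<open>2 / (1 + t\<^sup>2)\<close> since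
\<open>\<Sum> \<lambda>\<^sup>2 \<le> n\<close>, and dominated convergence gives the claim in mean (lemma \<open>expected_energy_centred_adjacency\<close>).\<close>

unbundle no inner_syntax and no vec_syntax

section \<open>Spectral theorem for real symmetric matrices\<close>

text \<open>The complexified matrix has an eigenvector \<open>w\<close> with eigenvalue \<open>z\<close>; by symmetry \<open>w\<^sup>* A w = z \<parallel>w\<parallel>\<^sup>2\<close>
is real, so \<open>z\<close> is real, and then the real and the imaginary part of \<open>w\<close> satisfy the same
eigenvalue equation. At least one of them is nonzero.\<close>

lemma symmetric_mat_unit_eigenvector:
  fixes A :: "real mat"
  assumes A: "A \<in> carrier_mat n n" and sym: "transpose_mat A = A" and n: "n > 0"
  shows "\<exists>v e. v \<in> carrier_vec n \<and> v \<bullet> v = 1 \<and> A *\<^sub>v v = e \<cdot>\<^sub>v v"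
proof -
  define C where "C = map_mat complex_of_real A"
  have C: "C \<in> carrier_mat n n" using A by (simp add: C_def)
  have symA: "A $$ (i,j) = A $$ (j,i)" if "i < n" "j < n" for i j
    using arg_cong[OF sym, of "\<lambda>M. M $$ (j,i)"] A that by simp
  obtain z where "z \<in> spectrum C" using spectrum_non_empty[OF C n] by blast
  then obtain w where w: "w \<in> carrier_vec n" "w \<noteq> 0\<^sub>v n" "C *\<^sub>v w = z \<cdot>\<^sub>v w"
    using C by (auto simp: spectrum_def eigenvalue_def eigenvector_def)
  have ev: "(\<Sum>j<n. of_real (A $$ (i,j)) * w $ j) = z * w $ i" if "i < n" for i
    using arg_cong[OF w(3), of "\<lambda>x. x $ i"] that w(1) A
    by (auto simp: C_def mult_mat_vec_def scalar_prod_def atLeast0LessThan)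
  define N where "N = (\<Sum>i<n. (cmod (w $ i))\<^sup>2)"
  have "N \<noteq> 0"
  proof
    assume "N = 0"
    hence "\<forall>i<n. w $ i = 0" by (simp add: N_def sum_nonneg_eq_0_iff)
    hence "w = 0\<^sub>v n" using w(1) by (intro eq_vecI) auto
    thus False using w by simp
  qed
  define S where "S = (\<Sum>i<n. \<Sum>j<n. of_real (A $$ (i,j)) * (cnj (w $ i) * w $ j))"
  have "S = (\<Sum>i<n. cnj (w $ i) * (\<Sum>j<n. of_real (A $$ (i,j)) * w $ j))"
    by (simp add: S_def sum_distrib_left algebra_simps)
  also have "\<dots> = (\<Sum>i<n. z * (w $ i * cnj (w $ i)))"
    by (intro sum.cong) (auto simp: ev)
  also have "\<dots> = z * of_real N"
    unfolding N_def of_real_sum complex_norm_square sum_distrib_left ..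
  finally have S1: "S = z * of_real N" .
  have "cnj S = (\<Sum>i<n. \<Sum>j<n. of_real (A $$ (i,j)) * (w $ i * cnj (w $ j)))"
    by (simp add: S_def)
  also have "\<dots> = (\<Sum>j<n. \<Sum>i<n. of_real (A $$ (i,j)) * (w $ i * cnj (w $ j)))"
    by (rule sum.swap)
  also have "\<dots> = S"
    unfolding S_def by (intro sum.cong refl) (use symA in \<open>auto simp: mult.commute\<close>)
  finally have "cnj z = z" using S1 \<open>N \<noteq> 0\<close> by simp
  hence z: "Im z = 0" by (metis Reals_cnj_iff complex_is_Real_iff)
  have key: "\<exists>v e. v \<in> carrier_vec n \<and> v \<bullet> v = 1 \<and> A *\<^sub>v v = e \<cdot>\<^sub>v v"
    if x: "\<And>i. i < n \<Longrightarrow> (\<Sum>j<n. A $$ (i,j) * x j) = Re z * x i" and nz: "k < n" "x k \<noteq> 0"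
    for x :: "nat \<Rightarrow> real" and k
  proof -
    define c where "c = sqrt (\<Sum>i<n. (x i)\<^sup>2)"
    have cpos: "(\<Sum>i<n. (x i)\<^sup>2) > 0" using nz by (intro sum_pos2[of _ k]) auto
    have c: "c > 0" "c\<^sup>2 = (\<Sum>i<n. (x i)\<^sup>2)" using cpos by (auto simp: c_def)
    define v where "v = vec n (\<lambda>i. x i / c)"
    have "v \<bullet> v = (\<Sum>i<n. (x i)\<^sup>2 / c\<^sup>2)"
      by (simp add: v_def scalar_prod_def atLeast0LessThan power2_eq_square)
    also have "\<dots> = 1" using cpos by (simp add: c(2) flip: sum_divide_distrib)
    finally have 1: "v \<bullet> v = 1" .
    have 2: "A *\<^sub>v v = Re z \<cdot>\<^sub>v v"
    proof (rule eq_vecI)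
      fix i assume "i < dim_vec (Re z \<cdot>\<^sub>v v)"
      hence i: "i < n" by (simp add: v_def)
      have "(A *\<^sub>v v) $ i = (\<Sum>j<n. A $$ (i,j) * x j) / c"
        using i A by (simp add: v_def scalar_prod_def atLeast0LessThan sum_divide_distrib)
      thus "(A *\<^sub>v v) $ i = (Re z \<cdot>\<^sub>v v) $ i" using i by (simp add: x v_def)
    qed (use A in \<open>auto simp: v_def\<close>)
    show ?thesis using 1 2 by (intro exI[of _ v] exI[of _ "Re z"]) (auto simp: v_def)
  qed
  obtain k where k: "k < n" "w $ k \<noteq> 0"
    using w(1,2) by (metis eq_vecI carrier_vecD index_zero_vec)
  have re: "(\<Sum>j<n. A $$ (i,j) * Re (w $ j)) = Re z * Re (w $ i)" if "i < n" for i
    using arg_cong[OF ev[OF that], of Re] z by simp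
  have im: "(\<Sum>j<n. A $$ (i,j) * Im (w $ j)) = Re z * Im (w $ i)" if "i < n" for i
    using arg_cong[OF ev[OF that], of Im] z by simp
  show ?thesis
  proof (cases "Re (w $ k) = 0")
    case False thus ?thesis using key[of "\<lambda>j. Re (w $ j)" k] re k by blast
  next
    case True
    hence "Im (w $ k) \<noteq> 0" using k by (simp add: complex_eq_iff)
    thus ?thesis using key[of "\<lambda>j. Im (w $ j)" k] im k by blast
  qed
qed

text \<open>The reflection that exchanges \<open>v\<close> with the first basis vector completes \<open>v\<close> to an orthonormal basis
by an explicit formula, which avoids any orthonormalisation procedure in the deflation step
of the spectral theorem.\<close>

lemma householder_reflection:
  fixes v :: "real vec"
  assumes v: "v \<in> carrier_vec n" "v \<bullet> v = 1" and n: "n > 0"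
  shows "\<exists>Q. Q \<in> carrier_mat n n \<and> transpose_mat Q = Q \<and> Q * Q = 1\<^sub>m n \<and> col Q 0 = v"
proof (cases "v = unit_vec n 0")
  case True
  thus ?thesis using n by (intro exI[of _ "1\<^sub>m n"]) auto
next
  case False
  define d where "d i j = (if i = j then 1 else 0 :: real)" for i j :: nat
  define w where "w i = v $ i - d i 0" for i
  define c where "c = (\<Sum>i<n. (w i)\<^sup>2)"
  define Q where "Q = Matrix.mat n n (\<lambda>(i,j). d i j - 2 * w i * w j / c)"
  have vv: "(\<Sum>i<n. (v $ i)\<^sup>2) = 1"
    using v by (simp add: scalar_prod_def atLeast0LessThan power2_eq_square)
  have "c \<noteq> 0"
  proof
    assume "c = 0"
    hence "\<forall>i<n. v $ i = d i 0" by (simp add: c_def w_def sum_nonneg_eq_0_iff)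
    hence "v = unit_vec n 0" using v n by (intro eq_vecI) (auto simp: d_def)
    thus False using False by simp
  qed
  have "c = (\<Sum>i<n. (v $ i)\<^sup>2 - 2 * (v $ i * d i 0) + d i 0)"
    unfolding c_def w_def by (intro sum.cong) (auto simp: d_def power2_eq_square algebra_simps)
  also have "\<dots> = 1 - 2 * v $ 0 + 1"
    using n by (simp add: sum.distrib sum_subtractf vv d_def if_distrib[of "\<lambda>x. _ * x"] cong: if_cong flip: sum_distrib_left)
  \<comment> \<open>Because \<open>v\<close> is a unit vector, the normalisation \<open>c\<close> is linear in \<open>w 0\<close>; this makes column \<open>0\<close> equal to \<open>v\<close>.\<close>
  finally have c: "c = - 2 * w 0" by (simp add: w_def d_def)
  have "transpose_mat Q = Q"
    unfolding Q_def by (intro eq_matI) (auto simp: d_def)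
  moreover have "Q * Q = 1\<^sub>m n"
  proof (rule eq_matI)
    fix i j assume "i < dim_row (1\<^sub>m n)" "j < dim_col (1\<^sub>m n)"
    hence ij: "i < n" "j < n" by auto
    have "(Q * Q) $$ (i,j) = (\<Sum>k<n. (d i k - 2 * w i * w k / c) * (d k j - 2 * w k * w j / c))"
      using ij by (simp add: Q_def scalar_prod_def atLeast0LessThan)
    also have "\<dots> = (\<Sum>k<n. d i k * d k j - 2 * w j / c * (d i k * w k) - 2 * w i / c * (w k * d k j)
         + 4 * w i * w j / c\<^sup>2 * (w k)\<^sup>2)"
      using \<open>c \<noteq> 0\<close> by (intro sum.cong refl) (simp add: field_simps power2_eq_square)
    also have "\<dots> = d i j - 2 * w j / c * w i - 2 * w i / c * w j + 4 * w i * w j / c\<^sup>2 * c"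
    proof -
      have "(\<Sum>k<n. d i k * d k j - x * (d i k * w k) - y * (w k * d k j) + z * (w k)\<^sup>2) =
          d i j - x * w i - y * w j + z * c" for x y z
        using ij unfolding c_def by (simp add: sum.distrib sum_subtractf d_def sum.delta'
          if_distrib[of "\<lambda>x. _ * x"] if_distrib[of "\<lambda>x. x * _"] cong: if_cong flip: sum_distrib_left)
      thus ?thesis .
    qed
    also have "\<dots> = d i j" using \<open>c \<noteq> 0\<close> by (simp add: field_simps power2_eq_square)
    finally show "(Q * Q) $$ (i,j) = 1\<^sub>m n $$ (i,j)" using ij by (simp add: d_def)
  qed (auto simp: Q_def)
  moreover have "col Q 0 = v"
  proof (rule eq_vecI)
    fix i assume "i < dim_vec v"
    hence i: "i < n" using v by simp
    have "col Q 0 $ i = d i 0 - 2 * w i * w 0 / c" using i n by (simp add: Q_def)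
    also have "\<dots> = v $ i" using \<open>c \<noteq> 0\<close> by (simp add: c field_simps) (simp add: w_def)
    finally show "col Q 0 $ i = v $ i" .
  qed (use v in \<open>auto simp: Q_def\<close>)
  ultimately show ?thesis by (intro exI[of _ Q]) (auto simp: Q_def)
qed

text \<open>Row \<open>k\<close> of \<open>u\<close> is the eigenvector to the eigenvalue \<open>l k\<close>. Matrices are plain functions here because the analysis below works with entries and finite sums.\<close>

definition orthonormal_eigensystem ::
    "nat \<Rightarrow> (nat \<Rightarrow> nat \<Rightarrow> real) \<Rightarrow> (nat \<Rightarrow> nat \<Rightarrow> real) \<Rightarrow> (nat \<Rightarrow> real) \<Rightarrow> bool" where
  "orthonormal_eigensystem n a u l \<longleftrightarrow>
     (\<forall>k<n. \<forall>k'<n. (\<Sum>i<n. u k i * u k' i) = (if k = k' then 1 else 0)) \<and>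
     (\<forall>i<n. \<forall>j<n. (\<Sum>k<n. u k i * u k j) = (if i = j then 1 else 0)) \<and>
     (\<forall>i<n. \<forall>j<n. a i j = (\<Sum>k<n. l k * u k i * u k j))"

text \<open>Deflation: conjugating by a reflection that sends the first basis vector to a unit eigenvector
leaves, by symmetry, a block diagonal matrix whose lower block is handled by induction.\<close>

lemma spectral_theorem_symmetric_mat:
  fixes A :: "real mat"
  assumes "A \<in> carrier_mat n n" and "transpose_mat A = A"
  shows "\<exists>U D. U \<in> carrier_mat n n \<and> D \<in> carrier_mat n n \<and> diagonal_mat D \<and>
           transpose_mat U * U = 1\<^sub>m n \<and> U * transpose_mat U = 1\<^sub>m n \<and>
           A = transpose_mat U * D * U"
  using assms
proof (induction n arbitrary: A)
  case 0
  thus ?case by (intro exI[of _ "1\<^sub>m 0"]) (auto simp: diagonal_mat_def)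
next
  case (Suc n A)
  note A = Suc.prems(1) and sym = Suc.prems(2)
  obtain v e where v: "v \<in> carrier_vec (Suc n)" "v \<bullet> v = 1" "A *\<^sub>v v = e \<cdot>\<^sub>v v"
    using symmetric_mat_unit_eigenvector[OF A sym] by auto
  obtain Q where Q: "Q \<in> carrier_mat (Suc n) (Suc n)" "transpose_mat Q = Q"
    "Q * Q = 1\<^sub>m (Suc n)" "col Q 0 = v"
    using householder_reflection[OF v(1,2)] by auto
  define B where "B = Q * A * Q"
  have B: "B \<in> carrier_mat (Suc n) (Suc n)" using Q A by (simp add: B_def)
  have symB: "transpose_mat B = B"
    using Q A sym by (simp add: B_def transpose_mult[of _ "Suc n" "Suc n" _ "Suc n"] assoc_mult_mat[of _ "Suc n" "Suc n" _ "Suc n" _ "Suc n"])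
  have QBQ: "Q * B * Q = A"
  proof -
    have "Q * B * Q = (Q * Q) * A * (Q * Q)"
      using Q(1) A by (simp add: B_def assoc_mult_mat[of _ "Suc n" "Suc n" _ "Suc n" _ "Suc n"])
    thus ?thesis using A by (simp add: Q(3))
  qed
  \<comment> \<open>\<open>Q\<close> maps the first basis vector to \<open>v\<close> and back, so the first column of \<open>B\<close> is \<open>e\<close> times that vector.\<close>
  have colB: "col B 0 = e \<cdot>\<^sub>v unit_vec (Suc n) 0"
  proof -
    have "col B 0 = Q * A *\<^sub>v v"
      unfolding B_def using Q(1) A by (subst col_mult2[of _ "Suc n" "Suc n" _ "Suc n"]) (auto simp: Q(4))
    also have "\<dots> = Q *\<^sub>v (e \<cdot>\<^sub>v v)" using Q(1) A v by (simp flip: v(3))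
    also have "\<dots> = e \<cdot>\<^sub>v (Q *\<^sub>v v)" using Q(1) v by (simp add: mult_mat_vec)
    also have "Q *\<^sub>v v = col (Q * Q) 0"
      using Q(1) by (subst col_mult2[of _ "Suc n" "Suc n" _ "Suc n"]) (auto simp: Q(4))
    also have "\<dots> = unit_vec (Suc n) 0" by (simp add: Q(3))
    finally show ?thesis .
  qed
  have B0: "B $$ (i,0) = (if i = 0 then e else 0)" if "i < Suc n" for i
    using arg_cong[OF colB, of "\<lambda>x. x $ i"] that B by (auto split: if_splits)
  have symB': "B $$ (i,j) = B $$ (j,i)" if "i < Suc n" "j < Suc n" for i j
    using arg_cong[OF symB, of "\<lambda>M. M $$ (j,i)"] B that by simp
  define B' where "B' = Matrix.mat n n (\<lambda>(i,j). B $$ (Suc i, Suc j))"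
  have B': "B' \<in> carrier_mat n n" by (simp add: B'_def)
  define E where "E = Matrix.mat 1 1 (\<lambda>_. e)"
  have E: "E \<in> carrier_mat 1 1" by (simp add: E_def)
  have Bblock: "B = four_block_mat E (0\<^sub>m 1 n) (0\<^sub>m n 1) B'"
  proof (rule eq_matI)
    fix i j assume "i < dim_row (four_block_mat E (0\<^sub>m 1 n) (0\<^sub>m n 1) B')"
      "j < dim_col (four_block_mat E (0\<^sub>m 1 n) (0\<^sub>m n 1) B')"
    hence ij: "i < Suc n" "j < Suc n" by (auto simp: E_def B'_def)
    show "B $$ (i,j) = four_block_mat E (0\<^sub>m 1 n) (0\<^sub>m n 1) B' $$ (i,j)"
      using ij B0[of i] B0[of j] symB'[of 0 j] by (auto simp: E_def B'_def)
  qed (use B in \<open>auto simp: E_def B'_def\<close>)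
  have "transpose_mat B' = B'"
    by (intro eq_matI) (auto simp: B'_def symB')
  from Suc.IH[OF B' this] obtain U' D' where U': "U' \<in> carrier_mat n n"
    and D': "D' \<in> carrier_mat n n" "diagonal_mat D'"
    and orth: "transpose_mat U' * U' = 1\<^sub>m n" "U' * transpose_mat U' = 1\<^sub>m n"
    and B'_eq: "B' = transpose_mat U' * D' * U'" by blast
  define V where "V = four_block_mat (1\<^sub>m 1) (0\<^sub>m 1 n) (0\<^sub>m n 1) U'"
  define D where "D = four_block_mat E (0\<^sub>m 1 n) (0\<^sub>m n 1) D'"
  define U where "U = V * Q"
  have V: "V \<in> carrier_mat (Suc n) (Suc n)"
    unfolding V_def using four_block_carrier_mat[OF one_carrier_mat[of 1] U'] by simp
  have D: "D \<in> carrier_mat (Suc n) (Suc n)"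
    unfolding D_def using four_block_carrier_mat[OF E D'(1)] by simp
  have VT: "transpose_mat V = four_block_mat (1\<^sub>m 1) (0\<^sub>m 1 n) (0\<^sub>m n 1) (transpose_mat U')"
    unfolding V_def by (subst transpose_four_block_mat[of _ 1 1 _ n _ n]) (use U' in auto)
  have one: "four_block_mat (1\<^sub>m 1) (0\<^sub>m 1 n) (0\<^sub>m n 1) (1\<^sub>m n) = (1\<^sub>m (Suc n) :: real mat)"
    by (rule eq_matI) auto
  have "transpose_mat V * V = 1\<^sub>m (Suc n)"
    unfolding VT unfolding V_def
    by (subst mult_four_block_mat[of _ 1 1 _ n _ n _ _ 1 _ n]) (use U' in \<open>auto simp: orth one\<close>)
  have VV2: "V * transpose_mat V = 1\<^sub>m (Suc n)"
    unfolding VT unfolding V_def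
    by (subst mult_four_block_mat[of _ 1 1 _ n _ n _ _ 1 _ n]) (use U' in \<open>auto simp: orth one\<close>)
  have BV: "B = transpose_mat V * D * V"
  proof -
    have "transpose_mat V * D = four_block_mat E (0\<^sub>m 1 n) (0\<^sub>m n 1) (transpose_mat U' * D')"
      unfolding VT D_def
      by (subst mult_four_block_mat[of _ 1 1 _ n _ n _ _ 1 _ n]) (use U' D' E in auto)
    moreover have "four_block_mat E (0\<^sub>m 1 n) (0\<^sub>m n 1) (transpose_mat U' * D') * V = B"
      unfolding V_def Bblock B'_eq
      by (subst mult_four_block_mat[of _ 1 1 _ n _ n _ _ 1 _ n]) (use U' D' E in auto)
    ultimately show ?thesis by simp
  qed
  have UT: "transpose_mat U = Q * transpose_mat V"
    unfolding U_def using Q V by (simp add: transpose_mult[of _ "Suc n" "Suc n" _ "Suc n"])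
  have *: "transpose_mat U * U = Q * (transpose_mat V * V) * Q"
    "U * transpose_mat U = V * (Q * Q) * transpose_mat V"
    "transpose_mat U * D * U = Q * B * Q"
    using Q(1) V D unfolding UT BV
    by (simp_all add: U_def assoc_mult_mat[of _ "Suc n" "Suc n" _ "Suc n" _ "Suc n"])
  have "diagonal_mat D"
    using D' E unfolding diagonal_mat_def D_def by (auto simp: E_def)
  moreover have "transpose_mat U * U = 1\<^sub>m (Suc n)" "U * transpose_mat U = 1\<^sub>m (Suc n)"
    using Q V \<open>transpose_mat V * V = 1\<^sub>m (Suc n)\<close> \<open>V * transpose_mat V = 1\<^sub>m (Suc n)\<close>
    by (simp_all add: *)
  moreover have "U \<in> carrier_mat (Suc n) (Suc n)" using V Q by (simp add: U_def)
  ultimately show ?case using D *(3) QBQ by metis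
qed

lemma symmetric_orthonormal_eigensystem:
  assumes "\<And>i j. i < n \<Longrightarrow> j < n \<Longrightarrow> a i j = a j i"
  obtains u l where "orthonormal_eigensystem n a u l"
proof -
  define A where "A = Matrix.mat n n (\<lambda>(i,j). a i j)"
  have A: "A \<in> carrier_mat n n" by (simp add: A_def)
  have "transpose_mat A = A" by (intro eq_matI) (auto simp: A_def assms)
  from spectral_theorem_symmetric_mat[OF A this] obtain U D where U: "U \<in> carrier_mat n n"
    and D: "D \<in> carrier_mat n n" "diagonal_mat D" and UU: "transpose_mat U * U = 1\<^sub>m n"
    "U * transpose_mat U = 1\<^sub>m n" and AU: "A = transpose_mat U * D * U" by blast
  have DU: "(transpose_mat U * D) $$ (i,k) = U $$ (k,i) * D $$ (k,k)" if "i < n" "k < n" for i k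
  proof -
    have "(transpose_mat U * D) $$ (i,k) = (\<Sum>j<n. U $$ (j,i) * D $$ (j,k))"
      using U D that by (simp add: scalar_prod_def atLeast0LessThan)
    also have "\<dots> = (\<Sum>j<n. if j = k then U $$ (k,i) * D $$ (k,k) else 0)"
      using D that by (intro sum.cong) (auto simp: diagonal_mat_def)
    finally show ?thesis using that by simp
  qed
  have "orthonormal_eigensystem n a (\<lambda>k i. U $$ (k,i)) (\<lambda>k. D $$ (k,k))"
    unfolding orthonormal_eigensystem_def
  proof (intro conjI allI impI)
    fix i j assume ij: "i < n" "j < n"
    show "(\<Sum>k<n. U $$ (i,k) * U $$ (j,k)) = (if i = j then 1 else 0)"
      using arg_cong[OF UU(2), of "\<lambda>M. M $$ (i,j)"] U ij by (simp add: scalar_prod_def atLeast0LessThan)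
    show "(\<Sum>k<n. U $$ (k,i) * U $$ (k,j)) = (if i = j then 1 else 0)"
      using arg_cong[OF UU(1), of "\<lambda>M. M $$ (i,j)"] U ij by (simp add: scalar_prod_def atLeast0LessThan)
    have M: "transpose_mat U * D \<in> carrier_mat n n" using U D by simp
    have "(M * U) $$ (i,j) = (\<Sum>k<n. M $$ (i,k) * U $$ (k,j))" if "M \<in> carrier_mat n n" for M
      using that U ij by (simp add: scalar_prod_def atLeast0LessThan)
    from this[OF M] have "a i j = (\<Sum>k<n. (transpose_mat U * D) $$ (i,k) * U $$ (k,j))"
      using arg_cong[OF AU, of "\<lambda>M. M $$ (i,j)"] ij by (simp add: A_def)
    also have "\<dots> = (\<Sum>k<n. D $$ (k,k) * U $$ (k,i) * U $$ (k,j))"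
      using ij by (intro sum.cong) (auto simp del: index_mult_mat(1) simp: DU mult_ac)
    finally show "a i j = (\<Sum>k<n. D $$ (k,k) * U $$ (k,i) * U $$ (k,j))" .
  qed
  thus ?thesis using that by blast
qed

section \<open>The energy as trace norm and its stability\<close>

lemma energy_eq_sum_abs_eigenvalues:
  assumes "orthonormal_eigensystem n a u l"
  shows "energy (Matrix.mat n n (\<lambda>(i,j). a i j)) = (\<Sum>k<n. \<bar>l k\<bar>)"
proof -
  define A where "A = Matrix.mat n n (\<lambda>(i,j). a i j)"
  define U where "U = Matrix.mat n n (\<lambda>(k,i). u k i)"
  define D where "D = Matrix.mat n n (\<lambda>(k,k'). if k = k' then l k else 0)"
  have [simp]: "A \<in> carrier_mat n n" "U \<in> carrier_mat n n" "D \<in> carrier_mat n n"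
    by (simp_all add: A_def U_def D_def)
  have 1: "transpose_mat U * U = 1\<^sub>m n"
    using assms unfolding orthonormal_eigensystem_def
    by (intro eq_matI) (auto simp: U_def scalar_prod_def atLeast0LessThan)
  have 2: "U * transpose_mat U = 1\<^sub>m n"
    using assms unfolding orthonormal_eigensystem_def
    by (intro eq_matI) (auto simp: U_def scalar_prod_def atLeast0LessThan)
  have 3: "A = transpose_mat U * D * U"
  proof (rule eq_matI)
    fix i j assume "i < dim_row (transpose_mat U * D * U)" "j < dim_col (transpose_mat U * D * U)"
    hence ij: "i < n" "j < n" by (auto simp: U_def)
    have "(transpose_mat U * D * U) $$ (i,j) = (\<Sum>k<n. (\<Sum>m<n. u m i * (if m = k then l m else 0)) * u k j)"
      using ij by (simp add: U_def D_def scalar_prod_def atLeast0LessThan)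
    also have "\<dots> = (\<Sum>k<n. l k * u k i * u k j)"
      by (intro sum.cong refl) (simp add: if_distrib[of "\<lambda>x. _ * x"] cong: if_cong)
    also have "\<dots> = A $$ (i,j)"
      using assms ij by (simp add: orthonormal_eigensystem_def A_def)
    finally show "A $$ (i,j) = (transpose_mat U * D * U) $$ (i,j)" ..
  qed (auto simp: A_def U_def)
  have "similar_mat A D"
    by (rule similar_matI[of _ _ "transpose_mat U" U n]) (auto simp: 1 2 3[symmetric])
  hence "char_poly A = char_poly D" by (rule char_poly_similar)
  also have "\<dots> = (\<Prod>a\<leftarrow>diag_mat D. [:-a, 1:])"
    by (rule char_poly_upper_triangular[of _ n]) (auto simp: D_def)
  also have "diag_mat D = map l [0..<n]" by (auto simp: diag_mat_def D_def)
  finally have cp: "char_poly A = (\<Prod>x\<leftarrow>map l [0..<n]. [:-x, 1:])" .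
  have "proots (\<Prod>x\<leftarrow>xs. [:-x, 1:]) = mset xs" for xs :: "real list"
  proof (induction xs)
    case (Cons x xs)
    have "(\<Prod>x\<leftarrow>xs. [:-x, 1:]) \<noteq> 0" by (auto simp: prod_list_zero_iff)
    hence "proots (\<Prod>x\<leftarrow>x # xs. [:-x, 1:]) = proots [:-x, 1:] + proots (\<Prod>x\<leftarrow>xs. [:-x, 1:])"
      unfolding list.map prod_list.Cons by (intro proots_mult) auto
    also have "proots [:-x, 1:] = {#x#}" by simp
    finally show ?case using Cons by simp
  qed auto
  hence "proots (char_poly A) = mset (map l [0..<n])" by (simp only: cp)
  hence "energy A = (\<Sum>x\<leftarrow>map l [0..<n]. \<bar>x\<bar>)"
    by (simp add: energy_def flip: sum_mset_sum_list mset_map)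
  also have "\<dots> = (\<Sum>k<n. \<bar>l k\<bar>)"
    by (simp add: o_def interv_sum_list_conv_sum_set_nat atLeast0LessThan)
  finally show ?thesis by (simp add: A_def)
qed

context
  fixes n :: nat and a u :: "nat \<Rightarrow> nat \<Rightarrow> real" and l :: "nat \<Rightarrow> real"
  assumes eig: "orthonormal_eigensystem n a u l"
begin

lemma eigenvectors_orthonormal:
  "k < n \<Longrightarrow> k' < n \<Longrightarrow> (\<Sum>i<n. u k i * u k' i) = (if k = k' then 1 else 0)"
  using eig by (simp add: orthonormal_eigensystem_def)

lemma eigenvectors_complete:
  "i < n \<Longrightarrow> j < n \<Longrightarrow> (\<Sum>k<n. u k i * u k j) = (if i = j then 1 else 0)"
  using eig by (simp add: orthonormal_eigensystem_def)

lemma matrix_eq_spectral_sum: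
  "i < n \<Longrightarrow> j < n \<Longrightarrow> a i j = (\<Sum>k<n. l k * u k i * u k j)"
  using eig by (simp add: orthonormal_eigensystem_def)

lemma orthonormal_norm_coeff: "(\<Sum>k<n. (\<Sum>i<n. u k i * x i)\<^sup>2) = (\<Sum>i<n. (x i)\<^sup>2)"
proof -
  have "(\<Sum>k<n. (\<Sum>i<n. u k i * x i)\<^sup>2) = (\<Sum>k<n. \<Sum>i<n. \<Sum>j<n. (x i * x j) * (u k i * u k j))"
    by (simp add: power2_eq_square sum_product mult_ac)
  also have "\<dots> = (\<Sum>i<n. \<Sum>k<n. \<Sum>j<n. (x i * x j) * (u k i * u k j))"
    by (rule sum.swap)
  also have "\<dots> = (\<Sum>i<n. \<Sum>j<n. \<Sum>k<n. (x i * x j) * (u k i * u k j))"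
    by (intro sum.cong refl sum.swap)
  also have "\<dots> = (\<Sum>i<n. \<Sum>j<n. (x i * x j) * (if i = j then 1 else 0))"
    by (intro sum.cong refl) (simp add: eigenvectors_complete flip: sum_distrib_left)
  also have "\<dots> = (\<Sum>i<n. (x i)\<^sup>2)"
    by (intro sum.cong refl) (simp add: power2_eq_square if_distrib[of "\<lambda>y. _ * y"] cong: if_cong)
  finally show ?thesis .
qed

lemma orthonormal_norm_combination: "(\<Sum>j<n. (\<Sum>k<n. x k * u k j)\<^sup>2) = (\<Sum>k<n. (x k)\<^sup>2)"
proof -
  have "(\<Sum>j<n. (\<Sum>k<n. x k * u k j)\<^sup>2) = (\<Sum>j<n. \<Sum>k<n. \<Sum>m<n. (x k * x m) * (u k j * u m j))"
    by (simp add: power2_eq_square sum_product mult_ac)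
  also have "\<dots> = (\<Sum>k<n. \<Sum>j<n. \<Sum>m<n. (x k * x m) * (u k j * u m j))"
    by (rule sum.swap)
  also have "\<dots> = (\<Sum>k<n. \<Sum>m<n. \<Sum>j<n. (x k * x m) * (u k j * u m j))"
    by (intro sum.cong refl sum.swap)
  also have "\<dots> = (\<Sum>k<n. \<Sum>m<n. (x k * x m) * (if k = m then 1 else 0))"
    by (intro sum.cong refl) (simp add: eigenvectors_orthonormal flip: sum_distrib_left)
  also have "\<dots> = (\<Sum>k<n. (x k)\<^sup>2)"
    by (intro sum.cong refl) (simp add: power2_eq_square if_distrib[of "\<lambda>y. _ * y"] cong: if_cong)
  finally show ?thesis .
qed

lemma matrix_eigenvector:
  assumes "k < n" "i < n"
  shows "(\<Sum>j<n. a i j * u k j) = l k * u k i"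
proof -
  have "(\<Sum>j<n. a i j * u k j) = (\<Sum>j<n. \<Sum>m<n. (l m * u m i) * (u m j * u k j))"
    by (intro sum.cong refl) (simp add: matrix_eq_spectral_sum assms sum_distrib_left mult_ac)
  also have "\<dots> = (\<Sum>m<n. \<Sum>j<n. (l m * u m i) * (u m j * u k j))" by (rule sum.swap)
  also have "\<dots> = (\<Sum>m<n. (l m * u m i) * (if m = k then 1 else 0))"
    by (intro sum.cong refl) (simp add: assms eigenvectors_orthonormal flip: sum_distrib_left)
  also have "\<dots> = l k * u k i" using assms by (simp add: if_distrib[of "\<lambda>y. _ * y"] cong: if_cong)
  finally show ?thesis .
qed

lemma quadratic_form_eigenvalues:
  "(\<Sum>i<n. \<Sum>j<n. x i * a i j * x j) = (\<Sum>k<n. l k * (\<Sum>i<n. u k i * x i)\<^sup>2)"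
proof -
  have "(\<Sum>i<n. \<Sum>j<n. x i * a i j * x j) = (\<Sum>i<n. \<Sum>j<n. \<Sum>k<n. l k * (u k i * x i) * (u k j * x j))"
    by (intro sum.cong refl) (simp add: matrix_eq_spectral_sum sum_distrib_right sum_distrib_left mult_ac)
  also have "\<dots> = (\<Sum>i<n. \<Sum>k<n. \<Sum>j<n. l k * (u k i * x i) * (u k j * x j))"
    by (intro sum.cong refl sum.swap)
  also have "\<dots> = (\<Sum>k<n. \<Sum>i<n. \<Sum>j<n. l k * (u k i * x i) * (u k j * x j))" by (rule sum.swap)
  also have "\<dots> = (\<Sum>k<n. l k * (\<Sum>i<n. u k i * x i)\<^sup>2)"
    by (simp add: power2_eq_square sum_product sum_distrib_left mult_ac)
  finally show ?thesis .
qed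

lemma eigenvalue_eq_quadratic_form:
  assumes "k < n"
  shows "l k = (\<Sum>i<n. \<Sum>j<n. u k i * a i j * u k j)"
proof -
  have "(\<Sum>i<n. \<Sum>j<n. u k i * a i j * u k j) = (\<Sum>i<n. u k i * (\<Sum>j<n. a i j * u k j))"
    by (simp add: sum_distrib_left mult_ac)
  also have "\<dots> = (\<Sum>i<n. l k * (u k i * u k i))"
    by (intro sum.cong refl) (simp add: matrix_eigenvector assms)
  also have "\<dots> = l k" using assms by (simp add: eigenvectors_orthonormal flip: sum_distrib_left)
  finally show ?thesis ..
qed

lemma sum_eigenvalues_squared: "(\<Sum>k<n. (l k)\<^sup>2) = (\<Sum>i<n. \<Sum>j<n. (a i j)\<^sup>2)"
proof -
  have "(\<Sum>i<n. \<Sum>j<n. (a i j)\<^sup>2) = (\<Sum>i<n. \<Sum>k<n. (\<Sum>j<n. u k j * a i j)\<^sup>2)"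
    by (simp add: orthonormal_norm_coeff)
  also have "\<dots> = (\<Sum>i<n. \<Sum>k<n. (l k)\<^sup>2 * (u k i)\<^sup>2)"
    using matrix_eigenvector by (intro sum.cong refl) (simp add: mult.commute power_mult_distrib)
  also have "\<dots> = (\<Sum>k<n. (l k)\<^sup>2 * (\<Sum>i<n. u k i * u k i))"
    by (subst sum.swap) (simp add: sum_distrib_left power2_eq_square)
  also have "\<dots> = (\<Sum>k<n. (l k)\<^sup>2)" by (simp add: eigenvectors_orthonormal)
  finally show ?thesis ..
qed

text \<open>Cauchy--Schwarz, once over \<open>k\<close> and once in each quadratic form, with Parseval's identity to
remove the orthonormal basis.\<close>

lemma sum_abs_quadratic_forms_le_frobenius:
  "(\<Sum>k<n. \<bar>\<Sum>i<n. \<Sum>j<n. u k i * d i j * u k j\<bar>) \<le> sqrt (real n * (\<Sum>i<n. \<Sum>j<n. (d i j)\<^sup>2))"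
proof (rule real_le_rsqrt)
  define q where "q k = (\<Sum>i<n. \<Sum>j<n. u k i * d i j * u k j)" for k
  have "(\<Sum>k<n. \<bar>q k\<bar>)\<^sup>2 \<le> real n * (\<Sum>k<n. (q k)\<^sup>2)"
    using Cauchy_Schwarz_ineq_sum[of "\<lambda>_. 1" "\<lambda>k. \<bar>q k\<bar>" "{..<n}"] by simp
  also have "(\<Sum>k<n. (q k)\<^sup>2) \<le> (\<Sum>k<n. \<Sum>i<n. (\<Sum>j<n. u k j * d i j)\<^sup>2)"
  proof (rule sum_mono)
    fix k assume k: "k \<in> {..<n}"
    have "q k = (\<Sum>i<n. u k i * (\<Sum>j<n. u k j * d i j))"
      by (simp add: q_def sum_distrib_left mult_ac)
    also have "\<dots>\<^sup>2 \<le> (\<Sum>i<n. (u k i)\<^sup>2) * (\<Sum>i<n. (\<Sum>j<n. u k j * d i j)\<^sup>2)"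
      by (rule Cauchy_Schwarz_ineq_sum)
    also have "(\<Sum>i<n. (u k i)\<^sup>2) = 1"
      using k by (simp add: power2_eq_square eigenvectors_orthonormal)
    finally show "(q k)\<^sup>2 \<le> (\<Sum>i<n. (\<Sum>j<n. u k j * d i j)\<^sup>2)" by simp
  qed
  also have "(\<Sum>k<n. \<Sum>i<n. (\<Sum>j<n. u k j * d i j)\<^sup>2) = (\<Sum>i<n. \<Sum>k<n. (\<Sum>j<n. u k j * d i j)\<^sup>2)"
    by (rule sum.swap)
  also have "\<dots> = (\<Sum>i<n. \<Sum>j<n. (d i j)\<^sup>2)" by (simp add: orthonormal_norm_coeff)
  finally show "(\<Sum>k<n. \<bar>\<Sum>i<n. \<Sum>j<n. u k i * d i j * u k j\<bar>)\<^sup>2 \<le> real n * (\<Sum>i<n. \<Sum>j<n. (d i j)\<^sup>2)"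
    by (simp add: q_def mult_left_mono)
qed

text \<open>The all-ones matrix is positive semidefinite, so the sum is its trace. The Frobenius estimate would lose
a factor \<open>\<surd>n\<close> here.\<close>

lemma sum_quadratic_forms_all_ones:
  "(\<Sum>k<n. \<bar>\<Sum>i<n. \<Sum>j<n. u k i * c * u k j\<bar>) = \<bar>c\<bar> * real n"
proof -
  have "(\<Sum>i<n. \<Sum>j<n. u k i * c * u k j) = c * (\<Sum>i<n. u k i * 1)\<^sup>2" for k
    by (simp add: power2_eq_square sum_product sum_distrib_left mult_ac)
  hence "(\<Sum>k<n. \<bar>\<Sum>i<n. \<Sum>j<n. u k i * c * u k j\<bar>) = \<bar>c\<bar> * (\<Sum>k<n. (\<Sum>i<n. u k i * 1)\<^sup>2)"
    by (simp add: abs_mult sum_distrib_left)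
  also have "(\<Sum>k<n. (\<Sum>i<n. u k i * 1)\<^sup>2) = real n"
    by (subst orthonormal_norm_coeff) simp
  finally show ?thesis .
qed

lemma sum_quadratic_forms_identity:
  "(\<Sum>k<n. \<bar>\<Sum>i<n. \<Sum>j<n. u k i * (if i = j then c else 0) * u k j\<bar>) = \<bar>c\<bar> * real n"
proof -
  have "(\<Sum>i<n. \<Sum>j<n. u k i * (if i = j then c else 0) * u k j) = c" if "k < n" for k
  proof -
    have "(\<Sum>i<n. \<Sum>j<n. u k i * (if i = j then c else 0) * u k j) = (\<Sum>i<n. c * (u k i * u k i))"
      by (intro sum.cong refl)
         (simp add: if_distrib[of "\<lambda>y. _ * y"] if_distrib[of "\<lambda>y. y * _"] cong: if_cong)
    thus ?thesis using that by (simp add: eigenvectors_orthonormal flip: sum_distrib_left)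
  qed
  thus ?thesis by simp
qed

end

text \<open>Write \<open>\<lambda>\<^sub>k = u\<^sub>k\<^sup>T b u\<^sub>k + u\<^sub>k\<^sup>T (a - b) u\<^sub>k\<close> and expand the first form in the eigenbasis \<open>v\<close> of \<open>b\<close>:
it is an average of the eigenvalues of \<open>b\<close> with the doubly stochastic weights \<open>\<langle>u\<^sub>k, v\<^sub>r\<rangle>\<^sup>2\<close>, so that
summing absolute values over \<open>k\<close> costs at most \<open>\<Sum> \<bar>m\<^sub>r\<bar>\<close>.\<close>

lemma sum_abs_eigenvalues_perturbation:
  assumes a: "orthonormal_eigensystem n a u l" and b: "orthonormal_eigensystem n b v m"
  shows "(\<Sum>k<n. \<bar>l k\<bar>) \<le> (\<Sum>k<n. \<bar>m k\<bar>) + (\<Sum>k<n. \<bar>\<Sum>i<n. \<Sum>j<n. u k i * (a i j - b i j) * u k j\<bar>)"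
proof -
  have swap: "(\<Sum>i<n. v r i * u k i) = (\<Sum>i<n. u k i * v r i)" for r k
    by (intro sum.cong refl mult.commute)
  have "(\<Sum>k<n. \<bar>l k\<bar>) \<le> (\<Sum>k<n. (\<Sum>r<n. \<bar>m r\<bar> * (\<Sum>i<n. u k i * v r i)\<^sup>2) +
          \<bar>\<Sum>i<n. \<Sum>j<n. u k i * (a i j - b i j) * u k j\<bar>)"
  proof (rule sum_mono)
    fix k assume k: "k \<in> {..<n}"
    have lk: "l k = (\<Sum>i<n. \<Sum>j<n. u k i * b i j * u k j) + (\<Sum>i<n. \<Sum>j<n. u k i * (a i j - b i j) * u k j)"
      using k eigenvalue_eq_quadratic_form[OF a, of k] by (simp add: algebra_simps flip: sum.distrib)
    have "\<bar>l k\<bar> \<le> \<bar>\<Sum>i<n. \<Sum>j<n. u k i * b i j * u k j\<bar> +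
        \<bar>\<Sum>i<n. \<Sum>j<n. u k i * (a i j - b i j) * u k j\<bar>"
      by (subst lk) (rule abs_triangle_ineq)
    moreover have "\<bar>\<Sum>i<n. \<Sum>j<n. u k i * b i j * u k j\<bar> \<le> (\<Sum>r<n. \<bar>m r * (\<Sum>i<n. v r i * u k i)\<^sup>2\<bar>)"
      unfolding quadratic_form_eigenvalues[OF b] by (rule sum_abs)
    ultimately show "\<bar>l k\<bar> \<le> (\<Sum>r<n. \<bar>m r\<bar> * (\<Sum>i<n. u k i * v r i)\<^sup>2) +
          \<bar>\<Sum>i<n. \<Sum>j<n. u k i * (a i j - b i j) * u k j\<bar>"
      by (simp add: abs_mult swap)
  qed
  also have "\<dots> = (\<Sum>r<n. \<bar>m r\<bar> * (\<Sum>k<n. (\<Sum>i<n. u k i * v r i)\<^sup>2)) +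
          (\<Sum>k<n. \<bar>\<Sum>i<n. \<Sum>j<n. u k i * (a i j - b i j) * u k j\<bar>)"
    unfolding sum.distrib sum_distrib_left by (rule arg_cong2[OF sum.swap refl, of "(+)"])
  also have "(\<Sum>r<n. \<bar>m r\<bar> * (\<Sum>k<n. (\<Sum>i<n. u k i * v r i)\<^sup>2)) = (\<Sum>k<n. \<bar>m k\<bar>)"
    by (intro sum.cong refl)
       (simp add: orthonormal_norm_coeff[OF a], simp add: power2_eq_square eigenvectors_orthonormal[OF b])
  finally show ?thesis .
qed

text \<open>Apart from the remainder \<open>d\<close>, the difference is \<open>c (J - I)\<close>, and \<open>J\<close> and \<open>I\<close> have trace norm \<open>n\<close>
each. Estimating this part separately from \<open>d\<close> makes the mean of an adjacency matrix harmless.\<close>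

lemma energy_perturbation_le:
  assumes sa: "\<And>i j. i < n \<Longrightarrow> j < n \<Longrightarrow> a i j = a j i"
    and sb: "\<And>i j. i < n \<Longrightarrow> j < n \<Longrightarrow> b i j = b j i"
    and ab: "\<And>i j. i < n \<Longrightarrow> j < n \<Longrightarrow> a i j - b i j = (if i = j then 0 else c) + d i j"
  shows "\<bar>energy (Matrix.mat n n (\<lambda>(i,j). a i j)) - energy (Matrix.mat n n (\<lambda>(i,j). b i j))\<bar>
           \<le> 2 * \<bar>c\<bar> * real n + sqrt (real n * (\<Sum>i<n. \<Sum>j<n. (d i j)\<^sup>2))"
proof -
  have bound: "(\<Sum>k<n. \<bar>\<Sum>i<n. \<Sum>j<n. u k i * x i j * u k j\<bar>) \<le>
      2 * \<bar>c'\<bar> * real n + sqrt (real n * (\<Sum>i<n. \<Sum>j<n. (d' i j)\<^sup>2))"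
    if e: "orthonormal_eigensystem n e u l"
      and x: "\<And>i j. i < n \<Longrightarrow> j < n \<Longrightarrow> x i j = (if i = j then 0 else c') + d' i j" for e u l x c' d'
  proof -
    have "(\<Sum>k<n. \<bar>\<Sum>i<n. \<Sum>j<n. u k i * x i j * u k j\<bar>) \<le>
       (\<Sum>k<n. \<bar>\<Sum>i<n. \<Sum>j<n. u k i * c' * u k j\<bar> +
         \<bar>\<Sum>i<n. \<Sum>j<n. u k i * (if i = j then - c' else 0) * u k j\<bar> +
         \<bar>\<Sum>i<n. \<Sum>j<n. u k i * d' i j * u k j\<bar>)"
    proof (rule sum_mono)
      fix k
      have "(\<Sum>i<n. \<Sum>j<n. u k i * x i j * u k j) =
         (\<Sum>i<n. \<Sum>j<n. u k i * c' * u k j) + (\<Sum>i<n. \<Sum>j<n. u k i * (if i = j then - c' else 0) * u k j) +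
         (\<Sum>i<n. \<Sum>j<n. u k i * d' i j * u k j)"
        unfolding sum.distrib[symmetric] by (intro sum.cong refl) (auto simp: x algebra_simps)
      thus "\<bar>\<Sum>i<n. \<Sum>j<n. u k i * x i j * u k j\<bar> \<le> \<bar>\<Sum>i<n. \<Sum>j<n. u k i * c' * u k j\<bar> +
         \<bar>\<Sum>i<n. \<Sum>j<n. u k i * (if i = j then - c' else 0) * u k j\<bar> +
         \<bar>\<Sum>i<n. \<Sum>j<n. u k i * d' i j * u k j\<bar>" by linarith
    qed
    also have "\<dots> \<le> \<bar>c'\<bar> * real n + \<bar>- c'\<bar> * real n + sqrt (real n * (\<Sum>i<n. \<Sum>j<n. (d' i j)\<^sup>2))"
      unfolding sum.distrib sum_quadratic_forms_all_ones[OF e] sum_quadratic_forms_identity[OF e]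
      by (intro add_left_mono sum_abs_quadratic_forms_le_frobenius[OF e])
    finally show ?thesis by simp
  qed
  obtain u l where a: "orthonormal_eigensystem n a u l" by (rule symmetric_orthonormal_eigensystem[OF sa])
  obtain v m where b: "orthonormal_eigensystem n b v m" by (rule symmetric_orthonormal_eigensystem[OF sb])
  have 1: "(\<Sum>k<n. \<bar>l k\<bar>) \<le> (\<Sum>k<n. \<bar>m k\<bar>) + (2 * \<bar>c\<bar> * real n + sqrt (real n * (\<Sum>i<n. \<Sum>j<n. (d i j)\<^sup>2)))"
    by (rule order.trans[OF sum_abs_eigenvalues_perturbation[OF a b] add_left_mono])
       (rule bound[OF a], simp add: ab)
  have 2: "(\<Sum>k<n. \<bar>m k\<bar>) \<le> (\<Sum>k<n. \<bar>l k\<bar>) +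
      (2 * \<bar>- c\<bar> * real n + sqrt (real n * (\<Sum>i<n. \<Sum>j<n. (- d i j)\<^sup>2)))"
    by (rule order.trans[OF sum_abs_eigenvalues_perturbation[OF b a] add_left_mono])
       (rule bound[OF b], use ab in \<open>force simp: algebra_simps\<close>)
  show ?thesis
    unfolding energy_eq_sum_abs_eigenvalues[OF a] energy_eq_sum_abs_eigenvalues[OF b]
    using 1 2 by simp
qed

lemma energy_scale:
  assumes sym: "\<And>i j. i < n \<Longrightarrow> j < n \<Longrightarrow> a i j = a j i"
  shows "energy (Matrix.mat n n (\<lambda>(i,j). c * a i j)) = \<bar>c\<bar> * energy (Matrix.mat n n (\<lambda>(i,j). a i j))"
proof -
  obtain u l where a: "orthonormal_eigensystem n a u l" by (rule symmetric_orthonormal_eigensystem[OF sym])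
  hence "orthonormal_eigensystem n (\<lambda>i j. c * a i j) u (\<lambda>k. c * l k)"
    by (auto simp: orthonormal_eigensystem_def sum_distrib_left mult_ac)
  from energy_eq_sum_abs_eigenvalues[OF this] energy_eq_sum_abs_eigenvalues[OF a]
  show ?thesis by (simp add: abs_mult sum_distrib_left)
qed

section \<open>Resolvents\<close>

text \<open>The matrix \<open>(a - z)\<inverse>\<close>, written through an eigensystem of \<open>a\<close>. Defined in this way its bounds are
immediate from orthonormality, and the inverse property becomes a lemma.\<close>

definition resolvent ::
    "nat \<Rightarrow> (nat \<Rightarrow> nat \<Rightarrow> real) \<Rightarrow> (nat \<Rightarrow> real) \<Rightarrow> complex \<Rightarrow> nat \<Rightarrow> nat \<Rightarrow> complex" where
  "resolvent n u l z i j = (\<Sum>k<n. of_real (u k i * u k j) / (of_real (l k) - z))"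

lemma resolvent_commute: "resolvent n u l z i j = resolvent n u l z j i"
  by (simp add: resolvent_def mult.commute)

lemma nonreal_denominator:
  assumes "Im z \<noteq> 0"
  shows "of_real x - z \<noteq> 0" and "\<bar>Im z\<bar> \<le> cmod (of_real x - z)"
proof -
  show "\<bar>Im z\<bar> \<le> cmod (of_real x - z)" using abs_Im_le_cmod[of "of_real x - z"] by simp
  thus "of_real x - z \<noteq> 0" using assms by (auto simp del: right_minus_eq)
qed

context
  fixes n :: nat and a u :: "nat \<Rightarrow> nat \<Rightarrow> real" and l :: "nat \<Rightarrow> real" and z :: complex
  assumes eig: "orthonormal_eigensystem n a u l" and z: "Im z \<noteq> 0"
begin

lemma matrix_times_resolvent:
  assumes "i < n" "j < n"
  shows "(\<Sum>b<n. of_real (a i b) * resolvent n u l z b j) = (if i = j then 1 else 0) + z * resolvent n u l z i j"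
proof -
  have "(\<Sum>b<n. of_real (a i b) * resolvent n u l z b j) =
      (\<Sum>b<n. \<Sum>k<n. of_real (a i b * u k b) * (of_real (u k j) / (of_real (l k) - z)))"
    by (simp add: resolvent_def sum_distrib_left mult_ac)
  also have "\<dots> = (\<Sum>k<n. \<Sum>b<n. of_real (a i b * u k b) * (of_real (u k j) / (of_real (l k) - z)))"
    by (rule sum.swap)
  also have "\<dots> = (\<Sum>k<n. of_real (\<Sum>b<n. a i b * u k b) * (of_real (u k j) / (of_real (l k) - z)))"
    by (simp only: sum_distrib_right of_real_sum)
  also have "\<dots> = (\<Sum>k<n. of_real (u k i * u k j) + z * (of_real (u k i * u k j) / (of_real (l k) - z)))"
  proof (intro sum.cong refl)
    fix k assume "k \<in> {..<n}"
    hence "(\<Sum>b<n. a i b * u k b) = l k * u k i" using matrix_eigenvector[OF eig] assms by simp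
    thus "of_real (\<Sum>b<n. a i b * u k b) * (of_real (u k j) / (of_real (l k) - z)) =
        of_real (u k i * u k j) + z * (of_real (u k i * u k j) / (of_real (l k) - z))"
      using nonreal_denominator(1)[OF z, of "l k"] by (simp add: divide_simps) (simp add: algebra_simps)
  qed
  also have "\<dots> = of_real (\<Sum>k<n. u k i * u k j) + z * resolvent n u l z i j"
    by (simp only: sum.distrib resolvent_def sum_distrib_left of_real_sum)
  finally show ?thesis using eigenvectors_complete[OF eig assms] by simp
qed

lemma resolvent_row_norm:
  assumes "i < n"
  shows "(\<Sum>j<n. (cmod (resolvent n u l z i j))\<^sup>2) \<le> 1 / (Im z)\<^sup>2"
proof -
  define c where "c k = of_real (u k i) / (of_real (l k) - z)" for k
  have G: "resolvent n u l z i j = (\<Sum>k<n. c k * of_real (u k j))" for j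
    by (simp add: resolvent_def c_def)
  have "(\<Sum>j<n. (cmod (resolvent n u l z i j))\<^sup>2) =
     (\<Sum>j<n. (\<Sum>k<n. Re (c k) * u k j)\<^sup>2) + (\<Sum>j<n. (\<Sum>k<n. Im (c k) * u k j)\<^sup>2)"
    by (simp add: G cmod_power2 sum.distrib)
  also have "\<dots> = (\<Sum>k<n. (cmod (c k))\<^sup>2)"
    by (simp add: orthonormal_norm_combination[OF eig] cmod_power2 sum.distrib)
  also have "\<dots> \<le> (\<Sum>k<n. (u k i)\<^sup>2 / (Im z)\<^sup>2)"
  proof (rule sum_mono)
    fix k
    have "cmod (c k) \<le> \<bar>u k i\<bar> / \<bar>Im z\<bar>"
      unfolding c_def norm_divide using nonreal_denominator[OF z, of "l k"] z
      by (intro frac_le) auto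
    from power_mono[OF this, of 2] show "(cmod (c k))\<^sup>2 \<le> (u k i)\<^sup>2 / (Im z)\<^sup>2"
      by (simp add: power_divide)
  qed
  also have "\<dots> = (\<Sum>k<n. u k i * u k i) / (Im z)\<^sup>2"
    by (simp add: power2_eq_square flip: sum_divide_distrib)
  also have "\<dots> = 1 / (Im z)\<^sup>2" using eigenvectors_complete[OF eig assms assms] by simp
  finally show ?thesis .
qed

lemma resolvent_entry_bound:
  assumes "i < n" "j < n"
  shows "cmod (resolvent n u l z i j) \<le> 1 / \<bar>Im z\<bar>"
proof -
  have "(cmod (resolvent n u l z i j))\<^sup>2 \<le> (\<Sum>j<n. (cmod (resolvent n u l z i j))\<^sup>2)"
    using assms by (intro member_le_sum) auto
  also have "\<dots> \<le> (1 / \<bar>Im z\<bar>)\<^sup>2" using resolvent_row_norm[OF assms(1)] by (simp add: power_divide)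
  finally show ?thesis by (rule power2_le_imp_le) simp
qed

lemma resolvent_sum_entries_bound:
  "(\<Sum>i<n. \<Sum>j<n. cmod (resolvent n u l z i j)) \<le> real n * sqrt (real n) / \<bar>Im z\<bar>"
proof -
  have "(\<Sum>i<n. \<Sum>j<n. cmod (resolvent n u l z i j)) \<le> (\<Sum>i<n. sqrt (real n) / \<bar>Im z\<bar>)"
  proof (rule sum_mono)
    fix i assume "i \<in> {..<n}"
    hence "real n * (\<Sum>j<n. (cmod (resolvent n u l z i j))\<^sup>2) \<le> real n * (1 / (Im z)\<^sup>2)"
      by (intro mult_left_mono resolvent_row_norm) auto
    hence "(\<Sum>j<n. cmod (resolvent n u l z i j))\<^sup>2 \<le> real n * (1 / (Im z)\<^sup>2)"
      using Cauchy_Schwarz_ineq_sum[of "\<lambda>_. 1" "\<lambda>j. cmod (resolvent n u l z i j)" "{..<n}"] by simp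
    also have "\<dots> = (sqrt (real n) / \<bar>Im z\<bar>)\<^sup>2" by (simp add: power_divide)
    finally show "(\<Sum>j<n. cmod (resolvent n u l z i j)) \<le> sqrt (real n) / \<bar>Im z\<bar>"
      by (rule power2_le_imp_le) simp
  qed
  thus ?thesis by simp
qed

lemma resolvent_trace: "(\<Sum>i<n. resolvent n u l z i i) = (\<Sum>k<n. 1 / (of_real (l k) - z))"
proof -
  have "(\<Sum>i<n. resolvent n u l z i i) = (\<Sum>k<n. of_real (\<Sum>i<n. u k i * u k i) / (of_real (l k) - z))"
    unfolding resolvent_def by (subst sum.swap) (simp add: sum_divide_distrib)
  also have "\<dots> = (\<Sum>k<n. 1 / (of_real (l k) - z))"
    by (intro sum.cong refl) (simp add: eigenvectors_orthonormal[OF eig] del: of_real_sum)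
  finally show ?thesis .
qed

end

text \<open>The resolvent identity \<open>G - G' = G (b - a) G'\<close> for matrices that differ in one symmetric pair
of entries.\<close>

lemma resolvent_rank_two_update:
  assumes a: "orthonormal_eigensystem n a u l" and b: "orthonormal_eigensystem n b v m" and z: "Im z \<noteq> 0"
    and pq: "p < n" "q < n" "p \<noteq> q"
    and ab: "\<And>i j. i < n \<Longrightarrow> j < n \<Longrightarrow> b i j - a i j = (if i = p \<and> j = q \<or> i = q \<and> j = p then \<epsilon> else 0)"
    and ij: "i < n" "j < n"
  shows "resolvent n u l z i j - resolvent n v m z i j = of_real \<epsilon> *
     (resolvent n u l z i p * resolvent n v m z q j + resolvent n u l z i q * resolvent n v m z p j)"
proof -
  let ?G = "resolvent n u l z" and ?H = "resolvent n v m z"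
  define S where "S = (\<Sum>r<n. \<Sum>s<n. ?G i r * of_real (b r s - a r s) * ?H s j)"
  have "S = (\<Sum>r<n. ?G i r * (\<Sum>s<n. of_real (b r s) * ?H s j)) -
            (\<Sum>r<n. \<Sum>s<n. ?G i r * of_real (a r s) * ?H s j)"
    by (simp add: S_def algebra_simps sum_distrib_left sum_subtractf)
  also have "(\<Sum>r<n. \<Sum>s<n. ?G i r * of_real (a r s) * ?H s j) = (\<Sum>s<n. \<Sum>r<n. ?G i r * of_real (a r s) * ?H s j)"
    by (rule sum.swap)
  also have "\<dots> = (\<Sum>s<n. (\<Sum>r<n. of_real (a s r) * ?G r i) * ?H s j)"
    unfolding sum_distrib_right
    by (intro sum.cong refl)
       (simp add: matrix_eq_spectral_sum[OF a] resolvent_commute[of n u l z i] mult_ac)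
  also have "\<dots> = (\<Sum>s<n. ((if s = i then 1 else 0) + z * ?G i s) * ?H s j)"
    using matrix_times_resolvent[OF a z _ ij(1)] resolvent_commute[of n u l z i]
    by (intro sum.cong refl) (metis lessThan_iff)
  also have "\<dots> = ?H i j + z * (\<Sum>s<n. ?G i s * ?H s j)"
  proof -
    have "(\<Sum>s<n. ((if s = i then 1 else 0) + z * ?G i s) * ?H s j) =
        (\<Sum>s<n. (if s = i then ?H i j else 0) + z * (?G i s * ?H s j))"
      by (intro sum.cong refl) (simp add: algebra_simps)
    thus ?thesis using ij by (simp add: sum.distrib sum_distrib_left)
  qed
  also have "(\<Sum>r<n. ?G i r * (\<Sum>s<n. of_real (b r s) * ?H s j)) =
      (\<Sum>r<n. ?G i r * ((if r = j then 1 else 0) + z * ?H r j))"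
    by (intro sum.cong refl) (simp add: matrix_times_resolvent[OF b z] ij)
  also have "\<dots> = ?G i j + z * (\<Sum>s<n. ?G i s * ?H s j)"
  proof -
    have "(\<Sum>r<n. ?G i r * ((if r = j then 1 else 0) + z * ?H r j)) =
        (\<Sum>r<n. (if r = j then ?G i j else 0) + z * (?G i r * ?H r j))"
      by (intro sum.cong refl) (simp add: algebra_simps)
    thus ?thesis using ij by (simp add: sum.distrib sum_distrib_left)
  qed
  finally have 1: "S = ?G i j - ?H i j" by simp
  have "S = (\<Sum>r<n. \<Sum>s<n. (if r = p then if s = q then ?G i p * of_real \<epsilon> * ?H q j else 0 else 0) +
         (if r = q then if s = p then ?G i q * of_real \<epsilon> * ?H p j else 0 else 0))"
    unfolding S_def by (intro sum.cong refl) (use pq(3) in \<open>auto simp: ab simp del: of_real_diff\<close>)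
  also have "\<dots> = (\<Sum>r<n. (if r = p then ?G i p * of_real \<epsilon> * ?H q j else 0) +
       (if r = q then ?G i q * of_real \<epsilon> * ?H p j else 0))"
    using pq by (intro sum.cong refl) (auto simp: sum.distrib)
  also have "\<dots> = of_real \<epsilon> * (?G i p * ?H q j + ?G i q * ?H p j)"
    using pq by (simp add: sum.distrib algebra_simps)
  finally show ?thesis using 1 by simp
qed

section \<open>Resampling one edge of the random graph\<close>

lemma finite_vertex_pairs: "finite (vertex_pairs n)"
  by (rule finite_subset[of _ "Pow {1..n}"]) (auto simp: vertex_pairs_def)

lemma set_pmf_gnp_subset: "set_pmf (gnp n p) \<subseteq> Pow (vertex_pairs n)"
  using set_Pi_pmf_subset[OF finite_vertex_pairs, of n False "\<lambda>_. bernoulli_pmf p"]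
  by (auto simp: gnp_def)

lemma finite_set_pmf_gnp: "finite (set_pmf (gnp n p))"
  by (rule finite_subset[OF set_pmf_gnp_subset]) (simp add: finite_vertex_pairs)

lemma integrable_gnp [simp, intro]:
  fixes F :: "nat set set \<Rightarrow> 'a :: {banach, second_countable_topology}"
  shows "integrable (measure_pmf (gnp n p)) F"
  by (rule integrable_measure_pmf_finite[OF finite_set_pmf_gnp])

lemma edge_in_vertex_pairs: "i < n \<Longrightarrow> j < n \<Longrightarrow> i \<noteq> j \<Longrightarrow> {Suc i, Suc j} \<in> vertex_pairs n"
  by (auto simp: vertex_pairs_def)

text \<open>The edges are independent, so the law of the graph is the product of the coin of \<open>e\<close> and the coins of
the other edges; fixing the first coin amounts to inserting or deleting \<open>e\<close>.\<close>

lemma gnp_resample_edge: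
  assumes e: "e \<in> vertex_pairs n"
  shows "gnp n p = bind_pmf (bernoulli_pmf p) (\<lambda>b. map_pmf (\<lambda>E. if b then insert e E else E - {e}) (gnp n p))"
proof -
  define V where "V = vertex_pairs n"
  have V: "finite V" "V = insert e (V - {e})" using e finite_vertex_pairs by (auto simp: V_def)
  define P where "P = (\<lambda>A. Pi_pmf A False (\<lambda>_::nat set. bernoulli_pmf p))"
  have "gnp n p = map_pmf (\<lambda>f. {x. f x}) (P (insert e (V - {e})))"
    using V(2) by (simp add: gnp_def P_def V_def)
  also have "P (insert e (V - {e})) = map_pmf (\<lambda>(y,f). f(e := y)) (pair_pmf (bernoulli_pmf p) (P (V - {e})))"
    unfolding P_def by (rule Pi_pmf_insert) (use V(1) in auto)
  also have "P (V - {e}) = map_pmf (\<lambda>f. f(e := False)) (P V)"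
    unfolding P_def by (rule Pi_pmf_remove) (use V(1) in auto)
  finally have "gnp n p = bind_pmf (bernoulli_pmf p) (\<lambda>b. map_pmf (\<lambda>f. {x. (f(e := b)) x}) (P V))"
    by (simp add: pair_pmf_def map_bind_pmf bind_map_pmf map_pmf_comp o_def flip: map_pmf_def)
  also have "\<dots> = bind_pmf (bernoulli_pmf p) (\<lambda>b. map_pmf (\<lambda>E. if b then insert e E else E - {e}) (gnp n p))"
    unfolding gnp_def map_pmf_comp P_def V_def
    by (intro bind_pmf_cong refl map_pmf_cong) auto
  finally show ?thesis .
qed

text \<open>The form of the resampling identity that is used to decouple an entry of the matrix from its
resolvent: on the right-hand side the state of \<open>e\<close> is deterministic in each term.\<close>

lemma expectation_gnp_resample_edge:
  fixes F :: "nat set set \<Rightarrow> 'a :: {banach, second_countable_topology}"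
  assumes e: "e \<in> vertex_pairs n" and p: "0 \<le> p" "p \<le> 1"
  shows "measure_pmf.expectation (gnp n p) F =
     p *\<^sub>R measure_pmf.expectation (gnp n p) (\<lambda>E. F (insert e E)) +
     (1 - p) *\<^sub>R measure_pmf.expectation (gnp n p) (\<lambda>E. F (E - {e}))"
proof -
  have "measure_pmf.expectation (gnp n p) F = (\<Sum>b\<in>UNIV. pmf (bernoulli_pmf p) b *\<^sub>R
      measure_pmf.expectation (map_pmf (\<lambda>E. if b then insert e E else E - {e}) (gnp n p)) F)"
    by (subst gnp_resample_edge[OF e], rule pmf_expectation_bind) (auto simp: finite_set_pmf_gnp)
  thus ?thesis using p by (simp add: UNIV_bool)
qed

section \<open>The semicircle equation for the trace of the resolvent\<close>

text \<open>The division by \<open>\<surd>n\<close> keeps the spectrum of order one: the squares of the eigenvalues add up to at most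
\<open>n\<close>.\<close>

definition centred_adjacency :: "nat \<Rightarrow> real \<Rightarrow> nat set set \<Rightarrow> nat \<Rightarrow> nat \<Rightarrow> real" where
  "centred_adjacency n p E i j =
     (if i = j then 0 else ((if {Suc i, Suc j} \<in> E then 1 else 0) - p) / sqrt (real n))"

lemma centred_adjacency_commute: "centred_adjacency n p E i j = centred_adjacency n p E j i"
  by (simp add: centred_adjacency_def insert_commute)

lemma centred_adjacency_edge_difference:
  assumes "i \<noteq> j"
  shows "centred_adjacency n p (insert {Suc i, Suc j} E) a b - centred_adjacency n p (E - {{Suc i, Suc j}}) a b =
      (if a = i \<and> b = j \<or> a = j \<and> b = i then 1 / sqrt (real n) else 0)"
proof -
  have "{Suc a, Suc b} = {Suc i, Suc j} \<longleftrightarrow> a = i \<and> b = j \<or> a = j \<and> b = i"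
    by (auto simp: doubleton_eq_iff)
  thus ?thesis using assms
    by (auto simp: centred_adjacency_def diff_divide_distrib)
qed

text \<open>The pointwise estimate behind the semicircle equation. The letters stand for entries of the
resolvents with the edge \<open>ij\<close> present (\<open>gp\<close>, \<open>gpi\<close>), absent (\<open>gm\<close>, \<open>gmj\<close>) and as it is in the
graph (\<open>g\<close>, \<open>gi\<close>, \<open>gj\<close>), \<open>r\<close> for \<open>\<surd>n\<close>, and \<open>Y\<close> for a bounded test function that changes little when
one edge is changed. The main term of the difference quotient on the left is \<open>- gi gj Y\<close>; what remains
is small either because it carries a factor \<open>1 / r\<close> or because it is controlled by \<open>g\<close>, and the
off-diagonal entries of a resolvent are of order \<open>1 / r\<close> on average.\<close>

lemma decoupling_error:
  fixes gp gm gpi gmj gi gj g Yp Ym Y :: complex and r K K0 t :: real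
  assumes t: "t > 0" and r: "r > 0"
    and update: "gm - gp = (gm * gp + gmj * gpi) / of_real r"
    and small: "cmod gp \<le> 1 / t" "cmod gpi \<le> 1 / t" "cmod gmj \<le> 1 / t" "cmod gi \<le> 1 / t" "cmod gj \<le> 1 / t"
    and close: "cmod (gm - g) \<le> 2 / t\<^sup>2 / r" "cmod (gmj - gj) \<le> 2 / t\<^sup>2 / r" "cmod (gpi - gi) \<le> 2 / t\<^sup>2 / r"
    and Y: "cmod Yp \<le> K" "cmod (Yp - Ym) \<le> K0 / r" "cmod (Yp - Y) \<le> K0 / r"
  shows "cmod (of_real r * (gp * Yp - gm * Ym) + gi * gj * Y)
     \<le> (K / t + K0) * cmod g + ((K / t + K0) * (2 / t\<^sup>2) + 4 * K / t ^ 3 + K0 / t\<^sup>2) / r"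
proof -
  have K: "K \<ge> 0" using Y(1) norm_ge_zero order.trans by blast
  have "K0 / r \<ge> 0" using Y(2) norm_ge_zero order.trans by blast
  hence K0: "K0 \<ge> 0" using r by (simp add: zero_le_divide_iff)
  have "of_real r * (gp - gm) = - (gm * gp + gmj * gpi)"
    using update r by (simp add: field_simps)
  moreover have "of_real r * (gp * Yp - gm * Ym) = (of_real r * (gp - gm)) * Yp + of_real r * gm * (Yp - Ym)"
    by (simp add: algebra_simps)
  ultimately have "of_real r * (gp * Yp - gm * Ym) = - (gm * gp + gmj * gpi) * Yp + of_real r * gm * (Yp - Ym)"
    by simp
  hence "of_real r * (gp * Yp - gm * Ym) + gi * gj * Y =
      - (gm * gp * Yp) + - ((gmj - gj) * gpi * Yp) + - (gj * (gpi - gi) * Yp) + - (gi * gj * (Yp - Y)) +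
       of_real r * gm * (Yp - Ym)"
    by (simp add: algebra_simps)
  moreover have "cmod (x1 + x2 + x3 + x4 + x5) \<le> cmod x1 + cmod x2 + cmod x3 + cmod x4 + cmod x5"
    for x1 x2 x3 x4 x5 :: complex
    by (intro order.trans[OF norm_triangle_ineq] add_mono order.refl)
  ultimately have "cmod (of_real r * (gp * Yp - gm * Ym) + gi * gj * Y) \<le>
     cmod (- (gm * gp * Yp)) + cmod (- ((gmj - gj) * gpi * Yp)) + cmod (- (gj * (gpi - gi) * Yp))
       + cmod (- (gi * gj * (Yp - Y))) + cmod (of_real r * gm * (Yp - Ym))"
    by (simp only:)
  also have "\<dots> =
     cmod gm * cmod gp * cmod Yp + cmod (gmj - gj) * cmod gpi * cmod Yp + cmod gj * cmod (gpi - gi) * cmod Yp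
       + cmod gi * cmod gj * cmod (Yp - Y) + r * cmod gm * cmod (Yp - Ym)"
    using r by (simp only: norm_minus_cancel norm_mult) simp
  also have "\<dots> \<le> cmod gm * (1 / t) * K + (2 / t\<^sup>2 / r) * (1 / t) * K + (1 / t) * (2 / t\<^sup>2 / r) * K
       + (1 / t) * (1 / t) * (K0 / r) + r * cmod gm * (K0 / r)"
    using t r K K0 by (intro add_mono mult_mono small close Y order.refl) auto
  also have "\<dots> = (K / t + K0) * cmod gm + (4 * K / t ^ 3 + K0 / t\<^sup>2) / r"
    using t r by (simp add: field_simps power2_eq_square power3_eq_cube)
  also have "cmod gm \<le> cmod g + 2 / t\<^sup>2 / r"
    using close(1) norm_triangle_ineq[of g "gm - g"] by simp
  also have "(K / t + K0) * (cmod g + 2 / t\<^sup>2 / r) + (4 * K / t ^ 3 + K0 / t\<^sup>2) / r =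
     (K / t + K0) * cmod g + ((K / t + K0) * (2 / t\<^sup>2) + 4 * K / t ^ 3 + K0 / t\<^sup>2) / r"
    by (simp add: algebra_simps add_divide_distrib)
  finally show ?thesis using t K K0 by (simp add: mult_left_mono)
qed

definition stieltjes ::
    "nat \<Rightarrow> (nat \<Rightarrow> nat \<Rightarrow> real) \<Rightarrow> (nat \<Rightarrow> real) \<Rightarrow> complex \<Rightarrow> complex" where
  "stieltjes n u l z = (\<Sum>i<n. resolvent n u l z i i) / of_nat n"

text \<open>The Stieltjes transform of the semicircle law of variance \<open>v\<close> at \<open>z\<close> is a root \<open>s\<close> of this
expression.\<close>

definition semicircle_equation :: "real \<Rightarrow> complex \<Rightarrow> complex \<Rightarrow> complex" where
  "semicircle_equation v z s = 1 + z * s + of_real v * s\<^sup>2"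

text \<open>The coefficients of the bound in \<open>decoupling_error\<close> for the conjugate of
\<open>1 + z s + v s\<^sup>2\<close> at \<open>z = \<i> t\<close> as test function: it is bounded by \<open>2 + 1 / t\<^sup>2\<close> and changes by at most
\<open>2 / t\<^sup>2 \<cdot> (t + 2 / t) / \<surd>n\<close> under the change of one edge. Only their independence of \<open>n\<close> matters.\<close>

definition decoupling_slope :: "real \<Rightarrow> real" where
  "decoupling_slope t = (2 + 1 / t\<^sup>2) / t + 2 / t\<^sup>2 * (t + 2 / t)"

definition decoupling_offset :: "real \<Rightarrow> real" where
  "decoupling_offset t =
     decoupling_slope t * (2 / t\<^sup>2) + 4 * (2 + 1 / t\<^sup>2) / t ^ 3 + 2 / t\<^sup>2 * (t + 2 / t) / t\<^sup>2"

text \<open>From here on an eigensystem of \<open>H\<close> is fixed for every graph; \<open>R\<close>, \<open>st\<close> and \<open>Q\<close> are the resolvent, its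
normalised trace and the defect of the semicircle equation at \<open>z = \<i> t\<close>.\<close>

context
  fixes n :: nat and p t :: real
    and U :: "nat set set \<Rightarrow> nat \<Rightarrow> nat \<Rightarrow> real" and L :: "nat set set \<Rightarrow> nat \<Rightarrow> real"
  assumes n: "n \<ge> 1" and p: "0 < p" "p < 1" and t: "t > 0"
    and eig: "\<And>E. orthonormal_eigensystem n (centred_adjacency n p E) (U E) (L E)"
begin

private abbreviation "Mean \<equiv> measure_pmf.expectation (gnp n p)"
private abbreviation "R E \<equiv> resolvent n (U E) (L E) (\<i> * of_real t)"

private abbreviation "st E \<equiv> stieltjes n (U E) (L E) (\<i> * of_real t)"
private abbreviation "Q E \<equiv> semicircle_equation (p * (1 - p)) (\<i> * of_real t) (st E)"

lemma imaginary_point: "Im (\<i> * of_real t) \<noteq> 0" "\<bar>Im (\<i> * of_real t)\<bar> = t"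
  using t by auto

lemma variance_le_1: "0 \<le> p * (1 - p)" "p * (1 - p) \<le> 1"
  using p mult_mono[of p 1 "1 - p" 1] by auto

lemma R_bound: "i < n \<Longrightarrow> j < n \<Longrightarrow> cmod (R E i j) \<le> 1 / t"
  using resolvent_entry_bound[OF eig imaginary_point(1)] imaginary_point(2) by simp

lemma R_edge_update:
  assumes ij: "i < n" "j < n" "i \<noteq> j" and ab: "a < n" "b < n"
  shows "R (E - {{Suc i, Suc j}}) a b - R (insert {Suc i, Suc j} E) a b =
     (R (E - {{Suc i, Suc j}}) a i * R (insert {Suc i, Suc j} E) j b +
      R (E - {{Suc i, Suc j}}) a j * R (insert {Suc i, Suc j} E) i b) / of_real (sqrt (real n))"
  using resolvent_rank_two_update[OF eig eig imaginary_point(1) ij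
      centred_adjacency_edge_difference[OF ij(3)] ab] by simp

lemma R_edge_difference_bound:
  assumes ij: "i < n" "j < n" "i \<noteq> j" and ab: "a < n" "b < n"
  shows "cmod (R (E - {{Suc i, Suc j}}) a b - R (insert {Suc i, Suc j} E) a b) \<le> 2 / t\<^sup>2 / sqrt (real n)"
proof -
  have "cmod (R (E - {{Suc i, Suc j}}) a i * R (insert {Suc i, Suc j} E) j b +
      R (E - {{Suc i, Suc j}}) a j * R (insert {Suc i, Suc j} E) i b) \<le> (1/t) * (1/t) + (1/t) * (1/t)"
    using t ij ab
    by (intro order.trans[OF norm_triangle_ineq] add_mono) (auto simp only: norm_mult intro!: mult_mono R_bound, auto)
  also have "\<dots> = 2 / t\<^sup>2" by (simp add: power2_eq_square)
  finally show ?thesis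
    unfolding R_edge_update[OF assms] norm_divide by (simp only: norm_of_real) (simp add: divide_right_mono del: divide_divide_eq_left)
qed

lemma stieltjes_bound: "cmod (st E) \<le> 1 / t"
proof -
  have "cmod (\<Sum>i<n. R E i i) \<le> (\<Sum>i<n. 1 / t)"
    by (intro order.trans[OF norm_sum] sum_mono R_bound) auto
  thus ?thesis using n t by (simp add: stieltjes_def norm_divide field_simps)
qed

lemma stieltjes_edge_difference_bound:
  assumes ij: "i < n" "j < n" "i \<noteq> j"
  shows "cmod (st (E - {{Suc i, Suc j}}) - st (insert {Suc i, Suc j} E)) \<le> 2 / t\<^sup>2 / sqrt (real n)"
proof -
  have "cmod (\<Sum>k<n. R (E - {{Suc i, Suc j}}) k k - R (insert {Suc i, Suc j} E) k k) \<le> (\<Sum>k<n. 2 / t\<^sup>2 / sqrt (real n))"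
    by (intro order.trans[OF norm_sum] sum_mono R_edge_difference_bound ij) auto
  hence "cmod ((\<Sum>k<n. R (E - {{Suc i, Suc j}}) k k - R (insert {Suc i, Suc j} E) k k) / of_nat n) \<le> 2 / t\<^sup>2 / sqrt (real n)"
    using n by (simp add: norm_divide field_simps)
  thus ?thesis by (simp add: stieltjes_def sum_subtractf diff_divide_distrib)
qed

lemma equation_defect_bound: "cmod (Q E) \<le> 2 + 1 / t\<^sup>2"
proof -
  have "cmod (Q E) \<le> 1 + t * cmod (st E) + (p * (1 - p)) * (cmod (st E))\<^sup>2"
    unfolding semicircle_equation_def
    by (intro order.trans[OF norm_triangle_ineq] add_mono)
       (use t variance_le_1(1) in \<open>simp_all add: norm_mult norm_power del: of_real_mult of_real_diff\<close>)
  also have "\<dots> \<le> 1 + t * (1 / t) + 1 * (1 / t)\<^sup>2"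
    using t variance_le_1 stieltjes_bound[of E] by (intro add_mono mult_mono power_mono) auto
  finally show ?thesis using t by (simp add: power_divide)
qed

lemma equation_defect_edge_difference_bound:
  assumes ij: "i < n" "j < n" "i \<noteq> j"
  shows "cmod (Q (insert {Suc i, Suc j} E) - Q (E - {{Suc i, Suc j}}))
     \<le> (2 / t\<^sup>2 * (t + 2 / t)) / sqrt (real n)"
proof -
  let ?s = "st (insert {Suc i, Suc j} E)" and ?s' = "st (E - {{Suc i, Suc j}})"
  have "Q (insert {Suc i, Suc j} E) - Q (E - {{Suc i, Suc j}}) =
      (?s - ?s') * (\<i> * of_real t + of_real (p * (1 - p)) * (?s + ?s'))"
    by (simp add: semicircle_equation_def algebra_simps power2_eq_square)
  also have "cmod \<dots> \<le> (2 / t\<^sup>2 / sqrt (real n)) * (t + 2 / t)"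
    unfolding norm_mult
  proof (rule mult_mono)
    show "cmod (?s - ?s') \<le> 2 / t\<^sup>2 / sqrt (real n)"
      using stieltjes_edge_difference_bound[OF ij, of E] by (simp add: norm_minus_commute)
    have "cmod (\<i> * of_real t + of_real (p * (1 - p)) * (?s + ?s')) \<le> t + (p * (1 - p)) * cmod (?s + ?s')"
      by (rule order.trans[OF norm_triangle_ineq])
         (use t variance_le_1(1) in \<open>simp add: norm_mult del: of_real_mult of_real_diff\<close>)
    also have "\<dots> \<le> t + 1 * (1 / t + 1 / t)"
      using variance_le_1 t
      by (intro add_left_mono mult_mono order.trans[OF norm_triangle_ineq] add_mono stieltjes_bound) auto
    finally show "cmod (\<i> * of_real t + of_real (p * (1 - p)) * (?s + ?s')) \<le> t + 2 / t" by simp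
  qed (use t in auto)
  finally show ?thesis by (simp add: algebra_simps)
qed

text \<open>Resampling the edge \<open>ij\<close> makes the entry \<open>h\<^sub>i\<^sub>j\<close> take the values \<open>(1 - p) / \<surd>n\<close> and \<open>- p / \<surd>n\<close> with
weights \<open>p\<close> and \<open>1 - p\<close>; so the mean of \<open>h\<^sub>i\<^sub>j G\<^sub>j\<^sub>i Y\<close> is \<open>p (1 - p) / \<surd>n\<close> times the mean change of
\<open>G\<^sub>j\<^sub>i Y\<close> between presence and absence of the edge, an exact identity that plays the role of
integration by parts for Gaussian entries.\<close>

lemma decoupled_entry_bound:
  assumes ij: "i < n" "j < n" "i \<noteq> j"
  shows "cmod (Mean (\<lambda>E. of_real (centred_adjacency n p E i j) * R E j i * cnj (Q E)) +
      of_real (p * (1 - p) / real n) * Mean (\<lambda>E. R E i i * R E j j * cnj (Q E)))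
    \<le> (decoupling_slope t * Mean (\<lambda>E. cmod (R E j i)) + decoupling_offset t / sqrt (real n)) / real n"
proof -
  let ?e = "{Suc i, Suc j}" and ?r = "sqrt (real n)"
  define Y where "Y E = cnj (Q E)" for E
  have r: "?r > 0" and r2: "?r * ?r = real n" using n by auto
  have p': "0 \<le> p" "p \<le> 1" using p by auto
  define D where "D E = of_real ?r * (R (insert ?e E) j i * Y (insert ?e E) - R (E - {?e}) j i * Y (E - {?e}))" for E
  have "Mean (\<lambda>E. of_real (centred_adjacency n p E i j) * R E j i * Y E) =
     p *\<^sub>R Mean (\<lambda>E. of_real ((1 - p) / ?r) * (R (insert ?e E) j i * Y (insert ?e E))) +
     (1 - p) *\<^sub>R Mean (\<lambda>E. of_real (- p / ?r) * (R (E - {?e}) j i * Y (E - {?e})))"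
    by (subst expectation_gnp_resample_edge[OF edge_in_vertex_pairs[OF ij] p'])
       (use ij in \<open>simp add: centred_adjacency_def mult.assoc\<close>)
  also have "\<dots> = of_real (p * (1 - p) / ?r) *
      (Mean (\<lambda>E. R (insert ?e E) j i * Y (insert ?e E)) - Mean (\<lambda>E. R (E - {?e}) j i * Y (E - {?e})))"
    by (simp add: scaleR_conv_of_real algebra_simps diff_divide_distrib)
  also have "\<dots> = of_real (p * (1 - p) / real n) * Mean D"
  proof -
    have "p * (1 - p) / ?r = p * (1 - p) / real n * ?r"
      using r n by (simp add: field_simps)
    hence "complex_of_real (p * (1 - p) / ?r) = of_real (p * (1 - p) / real n) * of_real ?r"
      by (simp only: of_real_mult)
    moreover have "Mean D = of_real ?r *
      (Mean (\<lambda>E. R (insert ?e E) j i * Y (insert ?e E)) - Mean (\<lambda>E. R (E - {?e}) j i * Y (E - {?e})))"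
      unfolding D_def integral_mult_right_zero by (simp add: Bochner_Integration.integral_diff)
    ultimately show ?thesis by (simp only: mult.assoc)
  qed
  finally have "Mean (\<lambda>E. of_real (centred_adjacency n p E i j) * R E j i * Y E) +
      of_real (p * (1 - p) / real n) * Mean (\<lambda>E. R E i i * R E j j * Y E) =
      of_real (p * (1 - p) / real n) * Mean (\<lambda>E. D E + R E i i * R E j j * Y E)"
    by (simp add: distrib_left)
  also have "cmod \<dots> \<le> (1 / real n) * Mean (\<lambda>E. decoupling_slope t * cmod (R E j i) + decoupling_offset t / ?r)"
    unfolding norm_mult
  proof (rule mult_mono)
    show "cmod (of_real (p * (1 - p) / real n)) \<le> 1 / real n"
      unfolding norm_of_real using variance_le_1 n by (simp add: abs_mult divide_right_mono)
    have pointwise: "cmod (D E + R E i i * R E j j * Y E) \<le> decoupling_slope t * cmod (R E j i) + decoupling_offset t / ?r" for E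
    proof -
      \<comment> \<open>The actual graph coincides with one of the two resampled graphs.\<close>
      have cases: "E = insert ?e E \<or> E = E - {?e}" by auto
      have near: "cmod (R (E - {?e}) a b - R E a b) \<le> 2 / t\<^sup>2 / ?r" "cmod (R (insert ?e E) a b - R E a b) \<le> 2 / t\<^sup>2 / ?r"
        if "a < n" "b < n" for a b
        using cases R_edge_difference_bound[OF ij that, of E] t
        by (metis norm_minus_commute cancel_comm_monoid_add_class.diff_cancel divide_nonneg_nonneg norm_zero
            of_nat_0_le_iff real_sqrt_ge_zero zero_le_numeral zero_le_power2)+
      have Ynear: "cmod (Y (insert ?e E) - Y (E - {?e})) \<le> (2 / t\<^sup>2 * (t + 2 / t)) / ?r"
        using equation_defect_edge_difference_bound[OF ij, of E]
        by (simp add: Y_def flip: complex_cnj_diff)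
      have "0 \<le> (2 / t\<^sup>2 * (t + 2 / t)) / ?r" using t by simp
      hence Ynear': "cmod (Y (insert ?e E) - Y E) \<le> (2 / t\<^sup>2 * (t + 2 / t)) / ?r"
        using cases Ynear by (metis cancel_comm_monoid_add_class.diff_cancel norm_zero)
      show ?thesis
        unfolding D_def decoupling_offset_def
        unfolding decoupling_slope_def
      proof (rule decoupling_error[where gpi = "R (insert ?e E) i i" and gmj = "R (E - {?e}) j j"])
        show "R (E - {?e}) j i - R (insert ?e E) j i = (R (E - {?e}) j i * R (insert ?e E) j i +
          R (E - {?e}) j j * R (insert ?e E) i i) / of_real ?r"
          by (rule R_edge_update) (use ij in auto)
        show "cmod (Y (insert ?e E)) \<le> 2 + 1 / t\<^sup>2" using equation_defect_bound by (simp add: Y_def)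
      qed (rule t r R_bound near Ynear Ynear' ij)+
    qed
    show "cmod (Mean (\<lambda>E. D E + R E i i * R E j j * Y E)) \<le> Mean (\<lambda>E. decoupling_slope t * cmod (R E j i) + decoupling_offset t / ?r)"
      by (rule order.trans[OF integral_norm_bound]) (intro integral_mono integrable_gnp pointwise)
  qed auto
  also have "\<dots> = (decoupling_slope t * Mean (\<lambda>E. cmod (R E j i)) + decoupling_offset t / ?r) / real n"
    by (subst Bochner_Integration.integral_add) (simp_all add: integral_const)
  finally show ?thesis by (simp add: Y_def)
qed

text \<open>Since \<open>H G = I + z G\<close>, \<open>n (1 + z s + v s\<^sup>2)\<close> is the sum over all \<open>i, j\<close> of
\<open>h\<^sub>i\<^sub>j G\<^sub>j\<^sub>i + v / n \<cdot> G\<^sub>i\<^sub>i G\<^sub>j\<^sub>j\<close>. Multiplying by the conjugate of the same expression makes the left-hand side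
a squared modulus, and the off-diagonal terms on the right are handled by the preceding lemma;
the \<open>n\<close> diagonal terms are estimated trivially.\<close>

lemma expected_squared_defect_bound:
  "Mean (\<lambda>E. (cmod (Q E))\<^sup>2) \<le>
     (decoupling_slope t / t + decoupling_offset t + (2 + 1 / t\<^sup>2) / t\<^sup>2) / sqrt (real n)"
proof -
  define Y where "Y E = cnj (Q E)" for E
  define T where "T i j = Mean (\<lambda>E. of_real (centred_adjacency n p E i j) * R E j i * Y E) +
      of_real (p * (1 - p) / real n) * Mean (\<lambda>E. R E i i * R E j j * Y E)" for i j
  define K where "K = (2 + 1 / t\<^sup>2) / t\<^sup>2"
  have K: "K \<ge> 0" by (simp add: K_def)
  have nonneg: "decoupling_slope t \<ge> 0" "decoupling_offset t \<ge> 0"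
    using t by (auto simp: decoupling_slope_def decoupling_offset_def)
  have expand: "of_nat n * (of_real ((cmod (Q E))\<^sup>2)) =
      (\<Sum>i<n. \<Sum>j<n. of_real (centred_adjacency n p E i j) * R E j i * Y E +
         of_real (p * (1 - p) / real n) * (R E i i * R E j j * Y E))" for E
  proof -
    have "(\<Sum>i<n. \<Sum>j<n. of_real (centred_adjacency n p E i j) * R E j i) =
       (\<Sum>i<n. 1 + \<i> * of_real t * R E i i)"
      by (intro sum.cong refl) (simp add: matrix_times_resolvent[OF eig imaginary_point(1)])
    also have "\<dots> = of_nat n * (1 + \<i> * of_real t * st E)"
      using n by (simp add: stieltjes_def sum.distrib distrib_left flip: sum_distrib_left)
    finally have 1: "(\<Sum>i<n. \<Sum>j<n. of_real (centred_adjacency n p E i j) * R E j i) =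
       of_nat n * (1 + \<i> * of_real t * st E)" .
    have "(\<Sum>i<n. \<Sum>j<n. R E i i * R E j j) = (of_nat n * st E)\<^sup>2"
      using n by (simp add: stieltjes_def power2_eq_square sum_product)
    hence 2: "(\<Sum>i<n. \<Sum>j<n. of_real (p * (1 - p) / real n) * (R E i i * R E j j)) =
        of_nat n * (of_real (p * (1 - p)) * (st E)\<^sup>2)"
      using n unfolding sum_distrib_left[symmetric] by (simp add: field_simps power2_eq_square)
    have "of_nat n * of_real ((cmod (Q E))\<^sup>2) = of_nat n * Q E * Y E"
      unfolding complex_norm_square Y_def by simp
    also have "of_nat n * Q E = (\<Sum>i<n. \<Sum>j<n. of_real (centred_adjacency n p E i j) * R E j i) +
        (\<Sum>i<n. \<Sum>j<n. of_real (p * (1 - p) / real n) * (R E i i * R E j j))"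
      unfolding 1 2 semicircle_equation_def by (simp add: algebra_simps)
    finally show ?thesis
      by (simp only: sum.distrib sum_distrib_right distrib_right mult.assoc)
  qed
  have "of_real (real n * Mean (\<lambda>E. (cmod (Q E))\<^sup>2)) =
      Mean (\<lambda>E. of_nat n * complex_of_real ((cmod (Q E))\<^sup>2))"
    by (simp only: integral_mult_right_zero integral_complex_of_real of_real_mult of_real_of_nat_eq)
  also have "\<dots> = (\<Sum>i<n. \<Sum>j<n. T i j)"
    unfolding expand T_def by (simp add: Bochner_Integration.integral_sum)
  finally have sum_T: "of_real (real n * Mean (\<lambda>E. (cmod (Q E))\<^sup>2)) = (\<Sum>i<n. \<Sum>j<n. T i j)" .
  have "real n * Mean (\<lambda>E. (cmod (Q E))\<^sup>2) = Re (\<Sum>i<n. \<Sum>j<n. T i j)"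
    unfolding sum_T[symmetric] by (simp only: Re_complex_of_real)
  also have "\<dots> \<le> (\<Sum>i<n. \<Sum>j<n. cmod (T i j))"
    by (intro order.trans[OF complex_Re_le_cmod] order.trans[OF norm_sum] sum_mono norm_sum)
  also have "\<dots> \<le> (\<Sum>i<n. \<Sum>j<n. (decoupling_slope t * Mean (\<lambda>E. cmod (R E j i)) + decoupling_offset t / sqrt (real n)
        + (if i = j then K else 0)) / real n)"
  proof (intro sum_mono)
    fix i j assume "i \<in> {..<n}" "j \<in> {..<n}"
    hence ij: "i < n" "j < n" by auto
    show "cmod (T i j) \<le> (decoupling_slope t * Mean (\<lambda>E. cmod (R E j i)) + decoupling_offset t / sqrt (real n)
        + (if i = j then K else 0)) / real n"
    proof (cases "i = j")
      case False
      thus ?thesis using decoupled_entry_bound[OF ij False] by (simp add: T_def Y_def)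
    next
      case True
      have "cmod (R E i i * R E j j * Y E) \<le> (1 / t) * (1 / t) * (2 + 1 / t\<^sup>2)" for E
        unfolding norm_mult Y_def complex_mod_cnj
        by (intro mult_mono R_bound ij equation_defect_bound) (use t in auto)
      hence "cmod (Mean (\<lambda>E. R E i i * R E j j * Y E)) \<le> Mean (\<lambda>E. (1 / t) * (1 / t) * (2 + 1 / t\<^sup>2))"
        by (intro order.trans[OF integral_norm_bound] integral_mono integrable_gnp)
      hence "cmod (Mean (\<lambda>E. R E i i * R E j j * Y E)) \<le> K"
        by (simp add: K_def power2_eq_square)
      hence "(p * (1 - p) / real n) * cmod (Mean (\<lambda>E. R E i i * R E j j * Y E)) \<le> 1 / real n * K"
        using variance_le_1 n K by (intro mult_mono divide_right_mono) auto
      moreover have "0 \<le> Mean (\<lambda>E. cmod (R E j i))" by (intro Bochner_Integration.integral_nonneg) auto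
      hence "0 \<le> (decoupling_slope t * Mean (\<lambda>E. cmod (R E j i)) + decoupling_offset t / sqrt (real n)) / real n"
        using nonneg by simp
      ultimately show ?thesis
        using True variance_le_1(1) by (simp add: T_def centred_adjacency_def norm_mult abs_divide add_divide_distrib
          del: of_real_mult of_real_diff of_real_divide)
    qed
  qed
  also have "\<dots> = (decoupling_slope t * Mean (\<lambda>E. \<Sum>i<n. \<Sum>j<n. cmod (R E i j)) +
       real n * real n * (decoupling_offset t / sqrt (real n)) + real n * K) / real n"
    by (simp add: sum.distrib Bochner_Integration.integral_sum sum_distrib_left resolvent_commute
         flip: sum_divide_distrib)
  also have "\<dots> \<le> (decoupling_slope t * (real n * sqrt (real n) / t) +
       real n * real n * (decoupling_offset t / sqrt (real n)) + real n * K) / real n"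
  proof -
    have "Mean (\<lambda>E. \<Sum>i<n. \<Sum>j<n. cmod (R E i j)) \<le> Mean (\<lambda>E. real n * sqrt (real n) / t)"
      using resolvent_sum_entries_bound[OF eig imaginary_point(1)] imaginary_point(2)
      by (intro integral_mono integrable_gnp) simp
    thus ?thesis using n nonneg by (intro divide_right_mono add_mono mult_left_mono) auto
  qed
  also have "\<dots> = real n * ((decoupling_slope t / t + decoupling_offset t) / sqrt (real n) + K / real n)"
  proof -
    have "sqrt (real n) = real n / sqrt (real n)" using n by (simp add: real_div_sqrt)
    hence "real n * sqrt (real n) / t = real n * (real n / sqrt (real n)) / t" by simp
    thus ?thesis using n t by (simp add: field_simps)
  qed
  finally have "Mean (\<lambda>E. (cmod (Q E))\<^sup>2) \<le> (decoupling_slope t / t + decoupling_offset t) / sqrt (real n) + K / real n"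
    using n by simp
  also have "K / real n \<le> K / sqrt (real n)"
    using K n by (intro divide_left_mono real_le_lsqrt mult_pos_pos) (auto simp: power2_eq_square)
  finally show ?thesis by (simp add: K_def add_divide_distrib)
qed

end

section \<open>From the resolvent to the energy\<close>

text \<open>The value of \<open>\<integral> x\<^sup>2 / (x\<^sup>2 + t\<^sup>2) d\<mu>(x)\<close> for the semicircle law \<open>\<mu>\<close> of variance \<open>v\<close>, that is,
\<open>1 - t Im s\<close> for the root \<open>s\<close> of the semicircle equation at \<open>\<i> t\<close> in the upper half plane.\<close>

definition semicircle_defect :: "real \<Rightarrow> real \<Rightarrow> real" where
  "semicircle_defect v t = 1 - t * (sqrt (t\<^sup>2 + 4 * v) - t) / (2 * v)"

lemma semicircle_defect_nonneg:
  assumes "v > 0"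
  shows "0 \<le> semicircle_defect v t"
proof -
  have "t * sqrt (t\<^sup>2 + 4 * v) \<le> sqrt ((t\<^sup>2 + 2 * v)\<^sup>2)"
  proof (rule real_le_rsqrt)
    show "(t * sqrt (t\<^sup>2 + 4 * v))\<^sup>2 \<le> (t\<^sup>2 + 2 * v)\<^sup>2"
      using assms by (simp add: power_mult_distrib) (simp add: power2_eq_square algebra_simps)
  qed
  hence "t * sqrt (t\<^sup>2 + 4 * v) \<le> t\<^sup>2 + 2 * v" using assms by simp
  thus ?thesis using assms by (simp add: semicircle_defect_def field_simps power2_eq_square)
qed

lemma has_bochner_integral_FTC_atLeast_0:
  fixes f F :: "real \<Rightarrow> real"
  assumes "f \<in> borel_measurable borel"
    and "\<And>x. 0 \<le> x \<Longrightarrow> (F has_real_derivative f x) (at x)"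
    and "\<And>x. 0 \<le> x \<Longrightarrow> 0 \<le> f x" and "(F \<longlongrightarrow> T) at_top"
  shows "has_bochner_integral lborel (\<lambda>t. indicator {0..} t * f t) (T - F 0)"
proof (rule has_bochner_integral_nn_integral)
  have "F 0 \<le> T"
  proof (rule tendsto_lowerbound[OF assms(4)])
    show "\<forall>\<^sub>F x in at_top. F 0 \<le> F x"
      using eventually_ge_at_top[of 0]
    proof eventually_elim
      case (elim x)
      show ?case
        by (rule DERIV_nonneg_imp_nondecreasing[OF elim]) (blast intro: assms(2,3))
    qed
  qed simp
  thus "0 \<le> T - F 0" by simp
  have "(\<integral>\<^sup>+t. ennreal (indicator {0..} t * f t) \<partial>lborel) = (\<integral>\<^sup>+t. ennreal (f t) * indicator {0..} t \<partial>lborel)"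
    by (intro nn_integral_cong) (auto simp: indicator_def)
  also have "\<dots> = ennreal (T - F 0)"
    by (rule nn_integral_FTC_atLeast) (use assms in auto)
  finally show "(\<integral>\<^sup>+t. ennreal (indicator {0..} t * f t) \<partial>lborel) = ennreal (T - F 0)" .
  show "AE t in lborel. 0 \<le> indicator {0..} t * f t"
    using assms(3) by (intro AE_I2) (auto simp: indicator_def)
qed (use assms(1) in measurable)

text \<open>The formula that turns the absolute value of an eigenvalue, which is not smooth, into an integral of
values that the resolvent on the imaginary axis can express.\<close>

lemma has_bochner_integral_abs_representation:
  "has_bochner_integral lborel (\<lambda>t. indicator {0..} t * (l\<^sup>2 / (l\<^sup>2 + t\<^sup>2))) (pi / 2 * \<bar>l\<bar>)"
proof (cases "l = 0")
  case False
  define m where "m = \<bar>l\<bar>"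
  have m: "m > 0" using False by (simp add: m_def)
  have "has_bochner_integral lborel (\<lambda>t. indicator {0..} t * (m\<^sup>2 / (m\<^sup>2 + t\<^sup>2)))
      (m * (pi / 2) - m * arctan (0 / m))"
  proof (rule has_bochner_integral_FTC_atLeast_0)
    fix t :: real
    have "m\<^sup>2 + t\<^sup>2 > 0" using m by (simp add: add_pos_nonneg)
    thus "((\<lambda>t. m * arctan (t / m)) has_real_derivative m\<^sup>2 / (m\<^sup>2 + t\<^sup>2)) (at t)"
      using m by (auto intro!: derivative_eq_intros simp: field_simps power2_eq_square)
  next
    have "filterlim (\<lambda>t. t / m) at_top at_top" using m by real_asymp
    from filterlim_compose[OF tendsto_arctan_at_top this]
    show "((\<lambda>t. m * arctan (t / m)) \<longlongrightarrow> m * (pi / 2)) at_top" by (intro tendsto_mult_left)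
  qed auto
  thus ?thesis by (simp add: m_def mult.commute)
qed (simp add: has_bochner_integral_zero)

lemma has_bochner_integral_semicircle_defect:
  assumes v: "v > 0"
  shows "has_bochner_integral lborel (\<lambda>t. indicator {0..} t * semicircle_defect v t) (4 / 3 * sqrt v)"
proof -
  \<comment> \<open>An antiderivative of the semicircle defect, normalised to vanish at infinity.\<close>
  define F where "F t = t + t ^ 3 / (6 * v) - (t\<^sup>2 + 4 * v) * sqrt (t\<^sup>2 + 4 * v) / (6 * v)" for t
  have "has_bochner_integral lborel (\<lambda>t. indicator {0..} t * semicircle_defect v t) (0 - F 0)"
  proof (rule has_bochner_integral_FTC_atLeast_0)
    fix t :: real
    have pos: "t\<^sup>2 + 4 * v > 0" using v by (simp add: add_nonneg_pos)
    define r where "r = sqrt (t\<^sup>2 + 4 * v)"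
    have r: "r > 0" "r * r = t\<^sup>2 + 4 * v" using pos by (auto simp: r_def)
    have inner: "((\<lambda>t. t\<^sup>2 + 4 * v) has_real_derivative 2 * t) (at t)"
      by (auto intro!: derivative_eq_intros)
    have root: "((\<lambda>t. sqrt (t\<^sup>2 + 4 * v)) has_real_derivative 2 * t / (2 * r)) (at t)"
      using pos by (auto intro!: derivative_eq_intros simp: r_def field_simps)
    have poly: "((\<lambda>t. t + t ^ 3 / (6 * v)) has_real_derivative 1 + 3 * t\<^sup>2 / (6 * v)) (at t)"
      using v by (auto intro!: derivative_eq_intros)
    have "(F has_real_derivative 1 + 3 * t\<^sup>2 / (6 * v) - (2 * t * r + 2 * t / (2 * r) * (t\<^sup>2 + 4 * v)) / (6 * v)) (at t)"
      unfolding F_def using DERIV_diff[OF poly DERIV_cdivide[OF DERIV_mult[OF inner root], of "6 * v"]]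
      by (simp add: r_def)
    moreover have "1 + 3 * t\<^sup>2 / (6 * v) - (2 * t * r + 2 * t / (2 * r) * (t\<^sup>2 + 4 * v)) / (6 * v) = semicircle_defect v t"
    proof -
      have defect: "semicircle_defect v t = 1 - t * (r - t) / (2 * v)"
        by (simp add: semicircle_defect_def r_def)
      show ?thesis unfolding r(2)[symmetric] defect using v r(1) by (simp add: field_simps power2_eq_square)
    qed
    ultimately show "(F has_real_derivative semicircle_defect v t) (at t)" by simp
  next
    show "(F \<longlongrightarrow> 0) at_top" unfolding F_def using v by real_asymp
  qed (use semicircle_defect_nonneg[OF v] in \<open>auto simp: semicircle_defect_def[abs_def]\<close>)
  moreover have "0 - F 0 = 4 / 3 * sqrt v"
    using v by (simp add: F_def real_sqrt_mult)
  ultimately show ?thesis by (simp only:)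
qed

text \<open>The two roots of the equation at \<open>\<i> t\<close> are \<open>\<i> y\<close> and \<open>- \<i> y'\<close> with \<open>y \<ge> 0\<close> and \<open>y' \<ge> t / v\<close>. A point of the
upper half plane has distance at least \<open>t / v\<close> from the second root, so a small defect
forces it to be close to the first one.\<close>

lemma semicircle_root_stability:
  assumes v: "v > 0" and t: "t > 0" and s: "Im s \<ge> 0"
  shows "\<bar>(1 - t * Im s) - semicircle_defect v t\<bar> \<le> cmod (1 + \<i> * of_real t * s + of_real v * s\<^sup>2)"
proof -
  define r where "r = sqrt (t\<^sup>2 + 4 * v)"
  have r2: "r\<^sup>2 = t\<^sup>2 + 4 * v" using v by (simp add: r_def add_nonneg_nonneg)
  have rt: "r \<ge> t" unfolding r_def using v by (intro real_le_rsqrt) auto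
  define y where "y = (r - t) / (2 * v)"
  define y' where "y' = (r + t) / (2 * v)"
  have yy: "y * y' = 1 / v" "y' - y = t / v"
    using v r2 by (auto simp: y_def y'_def field_simps power2_eq_square)
  have "of_real v * ((s - \<i> * of_real y) * (s + \<i> * of_real y')) =
      of_real v * s\<^sup>2 + \<i> * of_real (v * (y' - y)) * s + of_real (v * (y * y'))"
    by (simp add: algebra_simps power2_eq_square)
  also have "\<dots> = 1 + \<i> * of_real t * s + of_real v * s\<^sup>2"
    unfolding yy using v by simp
  finally have factorized: "1 + \<i> * of_real t * s + of_real v * s\<^sup>2 =
      of_real v * ((s - \<i> * of_real y) * (s + \<i> * of_real y'))" by (rule sym)
  have "cmod (1 + \<i> * of_real t * s + of_real v * s\<^sup>2) = v * (cmod (s - \<i> * of_real y) * cmod (s + \<i> * of_real y'))"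
    unfolding factorized norm_mult using v by simp
  moreover have "v * (\<bar>Im s - y\<bar> * (t / v)) \<le> v * (cmod (s - \<i> * of_real y) * cmod (s + \<i> * of_real y'))"
  proof (intro mult_left_mono mult_mono)
    show "\<bar>Im s - y\<bar> \<le> cmod (s - \<i> * of_real y)"
      using abs_Im_le_cmod[of "s - \<i> * of_real y"] by simp
    have "t / v \<le> y'" using v rt by (simp add: y'_def field_simps)
    also have "\<dots> \<le> Im (s + \<i> * of_real y')" using s by simp
    also have "\<dots> \<le> cmod (s + \<i> * of_real y')" using abs_Im_le_cmod[of "s + \<i> * of_real y'"] by linarith
    finally show "t / v \<le> cmod (s + \<i> * of_real y')" .
  qed (use v t in auto)
  moreover have "\<bar>(1 - t * Im s) - semicircle_defect v t\<bar> = v * (\<bar>Im s - y\<bar> * (t / v))"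
  proof -
    have "(1 - t * Im s) - semicircle_defect v t = - (t * (Im s - y))"
      by (simp add: semicircle_defect_def y_def r_def algebra_simps)
    thus ?thesis using t v by (simp add: abs_mult)
  qed
  ultimately show ?thesis by simp
qed

text \<open>Here \<open>\<lambda>\<^sup>2 / (\<lambda>\<^sup>2 + t\<^sup>2) = 1 - t Im (1 / (\<lambda> - \<i> t))\<close>, so root stability applies to each graph, and the
bound on the second moment of the defect bounds its mean.\<close>

lemma expected_resolvent_defect_bound:
  fixes p t :: real
  assumes n: "n \<ge> 1" and p: "0 < p" "p < 1" and t: "t > 0"
    and eig: "\<And>E. orthonormal_eigensystem n (centred_adjacency n p E) (U E) (L E)"
  shows "measure_pmf.expectation (gnp n p)
      (\<lambda>E. \<bar>(\<Sum>k<n. (L E k)\<^sup>2 / ((L E k)\<^sup>2 + t\<^sup>2)) / real n - semicircle_defect (p * (1 - p)) t\<bar>)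
     \<le> sqrt ((decoupling_slope t / t + decoupling_offset t + (2 + 1 / t\<^sup>2) / t\<^sup>2) / sqrt (real n))"
proof -
  define s where "s E = stieltjes n (U E) (L E) (\<i> * of_real t)" for E
  define Q where "Q E = semicircle_equation (p * (1 - p)) (\<i> * of_real t) (s E)" for E
  have trace: "s E = (\<Sum>k<n. 1 / (of_real (L E k) - \<i> * of_real t)) / of_nat n" for E
    using t resolvent_trace[OF eig, of "\<i> * of_real t"] by (simp add: s_def stieltjes_def)
  have Im_term: "Im (1 / (of_real x - \<i> * of_real t)) = t / (x\<^sup>2 + t\<^sup>2)" for x
    by (simp add: Im_divide power2_eq_square)
  have Im_s: "Im (s E) = (\<Sum>k<n. t / ((L E k)\<^sup>2 + t\<^sup>2)) / real n" for E
    unfolding trace by (simp only: Im_divide_of_nat Im_sum Im_term)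
  have Im_nonneg: "Im (s E) \<ge> 0" for E
    unfolding Im_s using t by (intro divide_nonneg_nonneg sum_nonneg) auto
  have defect: "(\<Sum>k<n. (L E k)\<^sup>2 / ((L E k)\<^sup>2 + t\<^sup>2)) / real n = 1 - t * Im (s E)" for E
  proof -
    have "(\<Sum>k<n. (L E k)\<^sup>2 / ((L E k)\<^sup>2 + t\<^sup>2)) = (\<Sum>k<n. 1 - t * (t / ((L E k)\<^sup>2 + t\<^sup>2)))"
    proof (intro sum.cong refl)
      fix k
      have "(L E k)\<^sup>2 + t\<^sup>2 \<noteq> 0" using t by (simp add: add_nonneg_eq_0_iff)
      thus "(L E k)\<^sup>2 / ((L E k)\<^sup>2 + t\<^sup>2) = 1 - t * (t / ((L E k)\<^sup>2 + t\<^sup>2))"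
        by (simp add: field_simps power2_eq_square)
    qed
    thus ?thesis using n by (simp add: Im_s sum_subtractf diff_divide_distrib sum_distrib_left)
  qed
  have "\<bar>(\<Sum>k<n. (L E k)\<^sup>2 / ((L E k)\<^sup>2 + t\<^sup>2)) / real n - semicircle_defect (p * (1 - p)) t\<bar> \<le> cmod (Q E)" for E
    unfolding defect using semicircle_root_stability[of "p * (1 - p)" t "s E"] p t Im_nonneg[of E]
    by (simp add: Q_def semicircle_equation_def)
  hence "measure_pmf.expectation (gnp n p)
      (\<lambda>E. \<bar>(\<Sum>k<n. (L E k)\<^sup>2 / ((L E k)\<^sup>2 + t\<^sup>2)) / real n - semicircle_defect (p * (1 - p)) t\<bar>)
     \<le> measure_pmf.expectation (gnp n p) (\<lambda>E. cmod (Q E))"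
    by (intro integral_mono integrable_gnp)
  also have "\<dots> \<le> sqrt (measure_pmf.expectation (gnp n p) (\<lambda>E. (cmod (Q E))\<^sup>2))"
  proof (rule real_le_rsqrt)
    \<comment> \<open>The mean is at most the root of the second moment because the variance is nonnegative.\<close>
    have "0 \<le> measure_pmf.variance (gnp n p) (\<lambda>E. cmod (Q E))"
      by (rule measure_pmf.variance_positive)
    also have "\<dots> = measure_pmf.expectation (gnp n p) (\<lambda>E. (cmod (Q E))\<^sup>2) -
        (measure_pmf.expectation (gnp n p) (\<lambda>E. cmod (Q E)))\<^sup>2"
      by (rule measure_pmf.variance_eq) auto
    finally show "(measure_pmf.expectation (gnp n p) (\<lambda>E. cmod (Q E)))\<^sup>2 \<le>
       measure_pmf.expectation (gnp n p) (\<lambda>E. (cmod (Q E))\<^sup>2)" by simp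
  qed
  also have "\<dots> \<le> sqrt ((decoupling_slope t / t + decoupling_offset t + (2 + 1 / t\<^sup>2) / t\<^sup>2) / sqrt (real n))"
    unfolding Q_def s_def by (intro real_sqrt_le_mono expected_squared_defect_bound[OF n p t eig])
  finally show ?thesis .
qed

text \<open>Convergence in mean. The energy divided by \<open>n\<close> is \<open>2 / \<pi>\<close> times the integral of \<open>g n E t\<close> over \<open>t \<ge> 0\<close>; the mean over
the graphs is a finite sum and passes under the integral, where the mean deviation tends to \<open>0\<close> for every
\<open>t > 0\<close> and is dominated.\<close>

lemma expected_energy_centred_adjacency:
  assumes p: "0 < p" "p < 1"
  shows "(\<lambda>n. measure_pmf.expectation (gnp n p)
      (\<lambda>E. \<bar>energy (Matrix.mat n n (\<lambda>(i,j). centred_adjacency n p E i j)) / real n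
            - 8 / (3 * pi) * sqrt (p * (1 - p))\<bar>)) \<longlonglongrightarrow> 0"
proof -
  define v where "v = p * (1 - p)"
  have v: "v > 0" using p by (simp add: v_def)
  obtain U L where eig: "\<And>n E. orthonormal_eigensystem n (centred_adjacency n p E) (U n E) (L n E)"
  proof -
    have "\<forall>n E. \<exists>u l. orthonormal_eigensystem n (centred_adjacency n p E) u l"
      using symmetric_orthonormal_eigensystem centred_adjacency_commute by meson
    thus ?thesis using that by metis
  qed
  define g where "g n E t = (\<Sum>k<n. (L n E k)\<^sup>2 / ((L n E k)\<^sup>2 + t\<^sup>2)) / real n" for n E t
  define M where "M n t = measure_pmf.expectation (gnp n p) (\<lambda>E. \<bar>g n E t - semicircle_defect v t\<bar>)" for n t
  have finite_sum: "measure_pmf.expectation (gnp n p) F = (\<Sum>E\<in>set_pmf (gnp n p). pmf (gnp n p) E * F E)" for n F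
    using integral_measure_pmf[OF finite_set_pmf_gnp[of n p], of "gnp n p" F] by simp
  have int_g: "has_bochner_integral lborel (\<lambda>t. indicator {0..} t * g n E t) (pi / 2 * ((\<Sum>k<n. \<bar>L n E k\<bar>) / real n))" for n E
  proof -
    have "has_bochner_integral lborel (\<lambda>t. (\<Sum>k<n. indicator {0..} t * ((L n E k)\<^sup>2 / ((L n E k)\<^sup>2 + t\<^sup>2))) / real n)
       ((\<Sum>k<n. pi / 2 * \<bar>L n E k\<bar>) / real n)"
      by (intro has_bochner_integral_divide_zero has_bochner_integral_sum has_bochner_integral_abs_representation)
    thus ?thesis by (simp add: g_def sum_distrib_left)
  qed
  have int_diff: "has_bochner_integral lborel (\<lambda>t. indicator {0..} t * (g n E t - semicircle_defect v t))
      (pi / 2 * ((\<Sum>k<n. \<bar>L n E k\<bar>) / real n) - 4 / 3 * sqrt v)" for n E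
    using has_bochner_integral_diff[OF int_g has_bochner_integral_semicircle_defect[OF v]]
    by (simp add: right_diff_distrib)
  have int_absdiff: "integrable lborel (\<lambda>t. indicator {0..} t * \<bar>g n E t - semicircle_defect v t\<bar>)" for n E
    using integrable_abs[OF integrable.intros[OF int_diff]] by (simp add: abs_mult)
  have M_sum: "indicator {0..} t * M n t = (\<Sum>E\<in>set_pmf (gnp n p). pmf (gnp n p) E *
      (indicator {0..} t * \<bar>g n E t - semicircle_defect v t\<bar>))" for n t
    by (simp add: M_def finite_sum sum_distrib_left mult_ac)
  have bound: "measure_pmf.expectation (gnp n p)
      (\<lambda>E. \<bar>energy (Matrix.mat n n (\<lambda>(i,j). centred_adjacency n p E i j)) / real n - 8 / (3 * pi) * sqrt v\<bar>)
      \<le> 2 / pi * (\<integral>t. indicator {0..} t * M n t \<partial>lborel)" for n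
  proof -
    have "\<bar>energy (Matrix.mat n n (\<lambda>(i,j). centred_adjacency n p E i j)) / real n - 8 / (3 * pi) * sqrt v\<bar> \<le>
        2 / pi * (\<integral>t. indicator {0..} t * \<bar>g n E t - semicircle_defect v t\<bar> \<partial>lborel)" for E
    proof -
      have "energy (Matrix.mat n n (\<lambda>(i,j). centred_adjacency n p E i j)) / real n - 8 / (3 * pi) * sqrt v =
         2 / pi * (\<integral>t. indicator {0..} t * (g n E t - semicircle_defect v t) \<partial>lborel)"
        unfolding has_bochner_integral_integral_eq[OF int_diff] energy_eq_sum_abs_eigenvalues[OF eig]
        by (simp add: field_simps)
      also have "\<bar>\<dots>\<bar> \<le> 2 / pi * (\<integral>t. \<bar>indicator {0..} t * (g n E t - semicircle_defect v t)\<bar> \<partial>lborel)"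
        using mult_left_mono[OF integral_abs_bound[of lborel
            "\<lambda>t. indicator {0..} t * (g n E t - semicircle_defect v t)"], of "2 / pi"]
        by (simp add: abs_mult)
      finally show ?thesis by (simp add: abs_mult)
    qed
    hence "measure_pmf.expectation (gnp n p)
      (\<lambda>E. \<bar>energy (Matrix.mat n n (\<lambda>(i,j). centred_adjacency n p E i j)) / real n - 8 / (3 * pi) * sqrt v\<bar>) \<le>
      measure_pmf.expectation (gnp n p)
       (\<lambda>E. 2 / pi * (\<integral>t. indicator {0..} t * \<bar>g n E t - semicircle_defect v t\<bar> \<partial>lborel))"
      by (intro integral_mono integrable_gnp)
    also have "\<dots> = 2 / pi * (\<integral>t. indicator {0..} t * M n t \<partial>lborel)"
    proof -
      have "(\<integral>t. indicator {0..} t * M n t \<partial>lborel) = (\<Sum>E\<in>set_pmf (gnp n p).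
          \<integral>t. pmf (gnp n p) E * (indicator {0..} t * \<bar>g n E t - semicircle_defect v t\<bar>) \<partial>lborel)"
        unfolding M_sum by (intro Bochner_Integration.integral_sum integrable_mult_right int_absdiff)
      also have "\<dots> = measure_pmf.expectation (gnp n p)
          (\<lambda>E. \<integral>t. indicator {0..} t * \<bar>g n E t - semicircle_defect v t\<bar> \<partial>lborel)"
        by (simp only: finite_sum integral_mult_right_zero)
      finally show ?thesis by simp
    qed
    finally show ?thesis .
  qed
  have M_limit: "(\<lambda>n. M n t) \<longlonglongrightarrow> 0" if t: "t > 0" for t
  proof (rule tendsto_sandwich[of "\<lambda>_. 0"])
    define C where "C = decoupling_slope t / t + decoupling_offset t + (2 + 1 / t\<^sup>2) / t\<^sup>2"
    show "\<forall>\<^sub>F n in sequentially. M n t \<le> sqrt (C / sqrt (real n))"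
      using eventually_ge_at_top[of 1]
    proof eventually_elim
      case (elim n)
      show ?case unfolding M_def g_def C_def v_def
        by (rule expected_resolvent_defect_bound[OF elim p t eig])
    qed
    show "(\<lambda>n. sqrt (C / sqrt (real n))) \<longlonglongrightarrow> 0"
    proof -
      have "(\<lambda>n. 1 / sqrt (real n)) \<longlonglongrightarrow> 0" by real_asymp
      from tendsto_real_sqrt[OF tendsto_mult_left[OF this, of C]] show ?thesis by simp
    qed
    show "\<forall>\<^sub>F n in sequentially. 0 \<le> M n t" by (simp add: M_def)
  qed simp
  have dominating: "integrable lborel (\<lambda>t. indicator {0..} t * (2 / (1 + t\<^sup>2)) + indicator {0..} t * semicircle_defect v t)"
  proof (rule Bochner_Integration.integrable_add)
    show "integrable lborel (\<lambda>t::real. indicator {0..} t * (2 / (1 + t\<^sup>2)))"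
      using integrable_mult_right[OF integrable.intros[OF has_bochner_integral_abs_representation[of 1]], of 2]
      by (simp add: mult_ac)
    show "integrable lborel (\<lambda>t. indicator {0..} t * semicircle_defect v t)"
      using has_bochner_integral_semicircle_defect[OF v] by (rule integrable.intros)
  qed
  have dominated: "norm (indicator {0..} t * M n t) \<le> indicator {0..} t * (2 / (1 + t\<^sup>2)) + indicator {0..} t * semicircle_defect v t" for n t
  proof -
    have pos: "1 + t\<^sup>2 > 0" by (simp add: add_pos_nonneg)
    have "\<bar>g n E t - semicircle_defect v t\<bar> \<le> 2 / (1 + t\<^sup>2) + semicircle_defect v t" for E
    proof -
      \<comment> \<open>This bound by \<open>(1 + x\<^sup>2) / (1 + t\<^sup>2)\<close> is sharp enough for large \<open>t\<close> and has no singularity at \<open>t = 0\<close>.\<close>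
      have summand: "x\<^sup>2 / (x\<^sup>2 + t\<^sup>2) \<le> (1 + x\<^sup>2) / (1 + t\<^sup>2)" for x
      proof (cases "x\<^sup>2 + t\<^sup>2 = 0")
        case False
        hence "x\<^sup>2 + t\<^sup>2 > 0" by (simp add: less_le)
        moreover have "x\<^sup>2 * (1 + t\<^sup>2) \<le> (1 + x\<^sup>2) * (x\<^sup>2 + t\<^sup>2)"
          by (simp add: algebra_simps)
        ultimately show ?thesis using pos by (simp add: divide_simps mult.commute)
      qed (use pos in auto)
      have "(\<Sum>k<n. (L n E k)\<^sup>2) = (\<Sum>i<n. \<Sum>j<n. (centred_adjacency n p E i j)\<^sup>2)"
        by (rule sum_eigenvalues_squared[OF eig])
      also have "\<dots> \<le> (\<Sum>i<n. \<Sum>j<n. 1 / real n)"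
      proof (intro sum_mono)
        fix i j
        have "((if {Suc i, Suc j} \<in> E then 1 else 0) - p)\<^sup>2 \<le> 1"
          using p by (simp add: abs_square_le_1)
        thus "(centred_adjacency n p E i j)\<^sup>2 \<le> 1 / real n"
          by (simp add: centred_adjacency_def power_divide divide_right_mono)
      qed
      also have "\<dots> \<le> real n" by simp
      finally have squares: "(\<Sum>k<n. (L n E k)\<^sup>2) \<le> real n" .
      have "g n E t \<le> (\<Sum>k<n. (1 + (L n E k)\<^sup>2) / (1 + t\<^sup>2)) / real n"
        unfolding g_def by (intro divide_right_mono sum_mono summand) auto
      also have "\<dots> = (real n + (\<Sum>k<n. (L n E k)\<^sup>2)) / (1 + t\<^sup>2) / real n"
        by (simp add: sum.distrib flip: sum_divide_distrib)
      also have "\<dots> \<le> (real n + real n) / (1 + t\<^sup>2) / real n"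
        using squares pos by (intro divide_right_mono add_left_mono) auto
      also have "\<dots> \<le> 2 / (1 + t\<^sup>2)" using pos by (cases "n = 0") (simp_all flip: mult_2)
      finally have "g n E t \<le> 2 / (1 + t\<^sup>2)" .
      moreover have "g n E t \<ge> 0" unfolding g_def by (intro divide_nonneg_nonneg sum_nonneg) auto
      ultimately show ?thesis using semicircle_defect_nonneg[OF v, of t] pos by linarith
    qed
    hence "M n t \<le> measure_pmf.expectation (gnp n p) (\<lambda>_. 2 / (1 + t\<^sup>2) + semicircle_defect v t)"
      unfolding M_def by (intro integral_mono integrable_gnp)
    moreover have "M n t \<ge> 0" by (simp add: M_def)
    ultimately show ?thesis by (auto simp: indicator_def)
  qed
  have "(\<lambda>n. \<integral>t. indicator {0..} t * M n t \<partial>lborel) \<longlonglongrightarrow> (\<integral>t. 0 \<partial>(lborel :: real measure))"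
  proof (rule integral_dominated_convergence[OF _ _ dominating])
    show "(\<lambda>t. indicator {0..} t * M n t) \<in> borel_measurable lborel" for n
      unfolding M_sum
      by (intro borel_measurable_sum borel_measurable_times[OF borel_measurable_const
            borel_measurable_integrable[OF int_absdiff]])
    have "AE t in lborel. t \<noteq> (0::real)" by (rule AE_lborel_singleton)
    thus "AE t in lborel. (\<lambda>n. indicator {0..} t * M n t) \<longlonglongrightarrow> 0"
    proof eventually_elim
      case (elim t)
      show ?case
        using M_limit[of t] elim by (cases "t > 0") auto
    qed
    show "AE t in lborel. norm (indicator {0..} t * M n t) \<le> indicator {0..} t * (2 / (1 + t\<^sup>2)) + indicator {0..} t * semicircle_defect v t" for n
      by (intro AE_I2 dominated)
  qed auto
  hence "(\<lambda>n. 2 / pi * (\<integral>t. indicator {0..} t * M n t \<partial>lborel)) \<longlonglongrightarrow> 2 / pi * 0"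
    by (intro tendsto_mult_left) simp
  hence lim: "(\<lambda>n. 2 / pi * (\<integral>t. indicator {0..} t * M n t \<partial>lborel)) \<longlonglongrightarrow> 0" by simp
  show ?thesis unfolding v_def[symmetric]
    by (rule tendsto_sandwich[OF _ _ tendsto_const lim]; rule always_eventually, rule allI)
       (simp, rule bound)
qed

section \<open>Concentration of the degrees\<close>

lemma degree_of_gnp_binomial:
  assumes i: "i \<in> {1..n}" and p: "0 \<le> p" "p \<le> 1"
  shows "map_pmf (\<lambda>E. degree_of E i) (gnp n p) = binomial_pmf (n - 1) p"
proof -
  define A where "A = {e \<in> vertex_pairs n. i \<in> e}"
  have A: "A \<subseteq> vertex_pairs n" "finite A"
    by (auto simp: A_def finite_vertex_pairs)
  have "A = (\<lambda>j. {i, j}) ` ({1..n} - {i})"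
  proof (intro equalityI subsetI)
    fix e assume "e \<in> A"
    hence e: "e \<subseteq> {1..n}" "card e = 2" "i \<in> e" by (auto simp: A_def vertex_pairs_def)
    then obtain j where "e = {i, j}" "i \<noteq> j" by (auto simp: card_2_iff)
    thus "e \<in> (\<lambda>j. {i, j}) ` ({1..n} - {i})" using e by auto
  qed (use i in \<open>auto simp: A_def vertex_pairs_def\<close>)
  moreover have "inj_on (\<lambda>j. {i, j}) ({1..n} - {i})" by (auto simp: inj_on_def doubleton_eq_iff)
  ultimately have card: "card A = n - 1" using i by (simp add: card_image)
  have "map_pmf (\<lambda>E. degree_of E i) (gnp n p) =
      map_pmf (\<lambda>f. card {e \<in> A. f e}) (Pi_pmf (vertex_pairs n) False (\<lambda>_. bernoulli_pmf p))"
    unfolding gnp_def map_pmf_comp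
  proof (rule map_pmf_cong[OF refl])
    fix f assume "f \<in> set_pmf (Pi_pmf (vertex_pairs n) False (\<lambda>_. bernoulli_pmf p))"
    hence "\<forall>e. f e \<longrightarrow> e \<in> vertex_pairs n"
      using set_Pi_pmf_subset[OF finite_vertex_pairs, of n False "\<lambda>_. bernoulli_pmf p"] by auto
    hence "{e \<in> {e. f e}. i \<in> e} = {e \<in> A. f e}" by (auto simp: A_def)
    thus "degree_of {e. f e} i = card {e \<in> A. f e}" by (simp add: degree_of_def)
  qed
  also have "\<dots> = map_pmf (\<lambda>f. card {e \<in> A. f e}) (Pi_pmf A False (\<lambda>_. bernoulli_pmf p))"
    by (subst Pi_pmf_subset[OF finite_vertex_pairs A(1)]) (auto simp: map_pmf_comp intro!: map_pmf_cong arg_cong[of _ _ card])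
  also have "\<dots> = binomial_pmf (n - 1) p"
    using binomial_pmf_altdef'[OF A(2) card, of p False] p by simp
  finally show ?thesis .
qed

text \<open>Hoeffding's inequality for the binomial distribution. It is centred at \<open>(n - 1) p\<close> instead of
\<open>n p\<close>; half of the admitted deviation \<open>\<delta> n \<ge> 2\<close> pays for the difference.\<close>

lemma degree_of_gnp_concentration:
  assumes n: "n \<ge> 2" and i: "i \<in> {1..n}" and p01: "0 \<le> p" "p \<le> 1" and \<delta>: "\<delta> > 0" "\<delta> * real n \<ge> 2"
  shows "measure_pmf.prob (gnp n p) {E. \<bar>real (degree_of E i) - real n * p\<bar> > \<delta> * real n}
           \<le> 2 * exp (- 2 * (real n - 1) * (\<delta> / 2)\<^sup>2)"
proof -
  interpret binomial_distribution "n - 1" p by unfold_locales (use p01 in auto)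
  have n1: "real (n - 1) = real n - 1" using n by simp
  have "measure_pmf.prob (gnp n p) {E. \<bar>real (degree_of E i) - real n * p\<bar> > \<delta> * real n} \<le>
     measure_pmf.prob (gnp n p) ((\<lambda>E. degree_of E i) -` {x. \<bar>real x / real (n - 1) - p\<bar> \<ge> \<delta> / 2})"
  proof (rule measure_pmf.finite_measure_mono)
    show "{E. \<bar>real (degree_of E i) - real n * p\<bar> > \<delta> * real n} \<subseteq>
        (\<lambda>E. degree_of E i) -` {x. \<bar>real x / real (n - 1) - p\<bar> \<ge> \<delta> / 2}"
    proof
      fix E assume "E \<in> {E. \<bar>real (degree_of E i) - real n * p\<bar> > \<delta> * real n}"
      hence *: "\<bar>real (degree_of E i) - real n * p\<bar> > \<delta> * real n" by simp
      let ?d = "real (degree_of E i)"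
      have "(\<delta> / 2) * (real n - 1) \<le> \<delta> * real n - 1" using \<delta> by (simp add: field_simps)
      also have "\<dots> \<le> \<bar>?d - (real n - 1) * p\<bar>" using * p01 unfolding left_diff_distrib by linarith
      also have "\<dots> = \<bar>?d / (real n - 1) - p\<bar> * (real n - 1)"
      proof -
        have "?d - (real n - 1) * p = (?d / (real n - 1) - p) * (real n - 1)"
          using n by (simp add: field_simps)
        thus ?thesis using n by (simp only: abs_mult)
      qed
      finally have "\<delta> / 2 \<le> \<bar>?d / (real n - 1) - p\<bar>"
        by (rule mult_right_le_imp_le) (use n in simp)
      thus "E \<in> (\<lambda>E. degree_of E i) -` {x. \<bar>real x / real (n - 1) - p\<bar> \<ge> \<delta> / 2}"
        unfolding n1 by simp
    qed
  qed simp
  also have "\<dots> = measure_pmf.prob (map_pmf (\<lambda>E. degree_of E i) (gnp n p)) {x. \<bar>real x / real (n - 1) - p\<bar> \<ge> \<delta> / 2}"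
    by simp
  also have "\<dots> \<le> 2 * exp (- 2 * real (n - 1) * (\<delta> / 2)\<^sup>2)"
    unfolding degree_of_gnp_binomial[OF i p01] using prob_abs_ge'[of "\<delta> / 2"] n \<delta> by simp
  finally show ?thesis unfolding n1 .
qed

text \<open>Union bound over the vertices; the exponential tail beats the factor \<open>n\<close>.\<close>

lemma all_degrees_concentrated:
  assumes p: "0 \<le> p" "p \<le> 1" and \<delta>: "\<delta> > 0"
  shows "(\<lambda>n. measure_pmf.prob (gnp n p)
      {E. \<exists>i\<in>{1..n}. \<bar>real (degree_of E i) - real n * p\<bar> > \<delta> * real n}) \<longlonglongrightarrow> 0"
proof (rule tendsto_sandwich[of "\<lambda>_. 0"])
  have "filterlim (\<lambda>n. \<delta> * real n) at_top sequentially" using \<delta> by real_asymp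
  hence "\<forall>\<^sub>F n in sequentially. \<delta> * real n \<ge> 2" by (simp add: filterlim_at_top)
  with eventually_ge_at_top[of 2]
  show "\<forall>\<^sub>F n in sequentially. measure_pmf.prob (gnp n p)
      {E. \<exists>i\<in>{1..n}. \<bar>real (degree_of E i) - real n * p\<bar> > \<delta> * real n} \<le>
      real n * (2 * exp (- 2 * (real n - 1) * (\<delta> / 2)\<^sup>2))"
  proof eventually_elim
    case (elim n)
    have "measure_pmf.prob (gnp n p) {E. \<exists>i\<in>{1..n}. \<bar>real (degree_of E i) - real n * p\<bar> > \<delta> * real n} =
       measure_pmf.prob (gnp n p) (\<Union>i\<in>{1..n}. {E. \<bar>real (degree_of E i) - real n * p\<bar> > \<delta> * real n})"
      by (intro arg_cong[of _ _ "measure_pmf.prob _"]) auto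
    also have "\<dots> \<le> (\<Sum>i\<in>{1..n}. measure_pmf.prob (gnp n p) {E. \<bar>real (degree_of E i) - real n * p\<bar> > \<delta> * real n})"
      by (rule measure_pmf.finite_measure_subadditive_finite) auto
    also have "\<dots> \<le> (\<Sum>i\<in>{1..n}. 2 * exp (- 2 * (real n - 1) * (\<delta> / 2)\<^sup>2))"
      by (intro sum_mono degree_of_gnp_concentration elim p \<delta>)
    finally show ?case by simp
  qed
  show "(\<lambda>n. real n * (2 * exp (- 2 * (real n - 1) * (\<delta> / 2)\<^sup>2))) \<longlonglongrightarrow> 0"
    using \<delta> by real_asymp
qed auto

section \<open>Graphs with nearly constant edge weights\<close>

text \<open>If all weights equal \<open>c\<close>, the matrix is \<open>c\<close> times the adjacency matrix
\<open>\<surd>n H + p (J - I)\<close>. The first error term is due to \<open>J - I\<close>, the second one to the deviation of the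
weights, whose Frobenius norm is at most \<open>n \<eta>\<close>.\<close>

lemma energy_edge_weights_near_constant:
  fixes w :: "nat \<Rightarrow> nat \<Rightarrow> real"
  assumes E: "E \<subseteq> vertex_pairs n" and n: "n \<ge> 1" and c: "c \<ge> 0" and p: "p \<ge> 0" and \<eta>: "\<eta> \<ge> 0"
    and sym: "\<And>i j. w i j = w j i"
    and near: "\<And>i j. i \<in> {1..n} \<Longrightarrow> j \<in> {1..n} \<Longrightarrow> {i, j} \<in> E \<Longrightarrow> \<bar>w i j - c\<bar> \<le> \<eta>"
  shows "\<bar>energy (edge_weight_mat n E w) -
      c * sqrt (real n) * energy (Matrix.mat n n (\<lambda>(i,j). centred_adjacency n p E i j))\<bar>
     \<le> 2 * c * p * real n + real n * sqrt (real n) * \<eta>"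
proof -
  define a where "a i j = (if {Suc i, Suc j} \<in> E then w (Suc i) (Suc j) else 0)" for i j
  define b where "b i j = c * sqrt (real n) * centred_adjacency n p E i j" for i j
  define d where "d i j = (if {Suc i, Suc j} \<in> E then w (Suc i) (Suc j) - c else 0)" for i j
  have "edge_weight_mat n E w = Matrix.mat n n (\<lambda>(i,j). a i j)"
    by (simp add: edge_weight_mat_def a_def)
  moreover have "energy (Matrix.mat n n (\<lambda>(i,j). b i j)) =
      c * sqrt (real n) * energy (Matrix.mat n n (\<lambda>(i,j). centred_adjacency n p E i j))"
    unfolding b_def using energy_scale[of n "centred_adjacency n p E" "c * sqrt (real n)"] c
      centred_adjacency_commute by simp
  moreover have "\<bar>energy (Matrix.mat n n (\<lambda>(i,j). a i j)) - energy (Matrix.mat n n (\<lambda>(i,j). b i j))\<bar>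
      \<le> 2 * \<bar>c * p\<bar> * real n + sqrt (real n * (\<Sum>i<n. \<Sum>j<n. (d i j)\<^sup>2))"
  proof (rule energy_perturbation_le)
    show "a i j = a j i" for i j by (simp add: a_def insert_commute sym)
    show "b i j = b j i" for i j by (simp add: b_def centred_adjacency_commute)
    show "a i j - b i j = (if i = j then 0 else c * p) + d i j" for i j
    proof (cases "i = j")
      case True
      have "{Suc i} \<notin> E" using E by (auto simp: vertex_pairs_def)
      thus ?thesis using True by (simp add: a_def b_def d_def centred_adjacency_def)
    next
      case False
      hence "b i j = c * ((if {Suc i, Suc j} \<in> E then 1 else 0) - p)"
        using n by (simp add: b_def centred_adjacency_def)
      thus ?thesis using False by (simp add: a_def d_def algebra_simps)
    qed
  qed
  moreover have "sqrt (real n * (\<Sum>i<n. \<Sum>j<n. (d i j)\<^sup>2)) \<le> real n * sqrt (real n) * \<eta>"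
  proof (rule real_le_lsqrt)
    have "(\<Sum>i<n. \<Sum>j<n. (d i j)\<^sup>2) \<le> (\<Sum>i<n. \<Sum>j<n. \<eta>\<^sup>2)"
    proof (intro sum_mono)
      fix i j assume "i \<in> {..<n}" "j \<in> {..<n}"
      hence "\<bar>d i j\<bar> \<le> \<eta>" using near[of "Suc i" "Suc j"] \<eta> by (auto simp: d_def)
      from power_mono[OF this, of 2] show "(d i j)\<^sup>2 \<le> \<eta>\<^sup>2" by simp
    qed
    hence "real n * (\<Sum>i<n. \<Sum>j<n. (d i j)\<^sup>2) \<le> real n * (\<Sum>i<n. \<Sum>j<n. \<eta>\<^sup>2)"
      by (rule mult_left_mono) simp
    also have "\<dots> = (real n * sqrt (real n) * \<eta>)\<^sup>2"
      by (simp add: power_mult_distrib power2_eq_square)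
    finally show "real n * (\<Sum>i<n. \<Sum>j<n. (d i j)\<^sup>2) \<le> (real n * sqrt (real n) * \<eta>)\<^sup>2" .
  qed (use \<eta> in auto)
  ultimately show ?thesis using c p by (simp add: abs_mult)
qed

text \<open>The common form of the two claims: if the edge weights are uniformly asymptotic to \<open>c n\<close> with high
probability, the energy is asymptotic to that of \<open>c n\<close> times the adjacency matrix.\<close>

lemma energy_edge_weights_asymptotics:
  fixes W :: "nat \<Rightarrow> nat set set \<Rightarrow> nat \<Rightarrow> nat \<Rightarrow> real" and c :: "nat \<Rightarrow> real"
  assumes p: "0 < p" "p < 1"
    and sym: "\<And>n E i j. W n E i j = W n E j i"
    and c: "\<forall>\<^sub>F n in sequentially. c n > 0"
    and near: "\<And>\<eta>. \<eta> > 0 \<Longrightarrow> (\<lambda>n. measure_pmf.prob (gnp n p)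
        {E. \<exists>i\<in>{1..n}. \<exists>j\<in>{1..n}. {i, j} \<in> E \<and> \<bar>W n E i j - c n\<bar> > \<eta> * c n}) \<longlonglongrightarrow> 0"
  shows "asymp_almost_all p (\<lambda>n E. energy (edge_weight_mat n E (W n E)))
     (\<lambda>n. 8 / (3 * pi) * sqrt (p * (1 - p)) * (c n * (real n * sqrt (real n))))"
  unfolding asymp_almost_all_def
proof (intro allI impI)
  fix \<epsilon> :: real assume \<epsilon>: "\<epsilon> > 0"
  define K where "K = 8 / (3 * pi) * sqrt (p * (1 - p))"
  have K: "K > 0" using p by (simp add: K_def)
  define H where "H n E = energy (Matrix.mat n n (\<lambda>(i,j). centred_adjacency n p E i j))" for n E
  define X where "X n E = energy (edge_weight_mat n E (W n E))" for n E
  \<comment> \<open>Three errors, each a third of the admissible \<open>K \<epsilon>\<close>: from \<open>J - I\<close>, from the weights, and from \<open>H\<close>.\<close>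
  define \<eta> where "\<eta> = K * \<epsilon> / 3"
  have \<eta>: "\<eta> > 0" using K \<epsilon> by (simp add: \<eta>_def)
  define bad where "bad n = {E. \<exists>i\<in>{1..n}. \<exists>j\<in>{1..n}. {i, j} \<in> E \<and> \<bar>W n E i j - c n\<bar> > \<eta> * c n}" for n
  define M where "M n = measure_pmf.expectation (gnp n p) (\<lambda>E. \<bar>H n E / real n - K\<bar>)" for n
  have "(\<lambda>n. 2 * p / sqrt (real n)) \<longlonglongrightarrow> 0" using p by real_asymp
  hence small: "\<forall>\<^sub>F n in sequentially. 2 * p / sqrt (real n) < \<eta>"
    using \<eta> by (rule order_tendstoD)
  show "(\<lambda>n. measure_pmf.prob (gnp n p) {E. \<epsilon> < \<bar>X n E / (K * (c n * (real n * sqrt (real n)))) - 1\<bar>}) \<longlonglongrightarrow> 0"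
  proof (rule tendsto_sandwich[of "\<lambda>_. 0"])
    show "(\<lambda>n. measure_pmf.prob (gnp n p) (bad n) + M n / \<eta>) \<longlonglongrightarrow> 0"
    proof -
      have "M \<longlonglongrightarrow> 0" unfolding M_def H_def K_def by (rule expected_energy_centred_adjacency[OF p])
      from tendsto_add[OF near[OF \<eta>] tendsto_divide[OF this tendsto_const]] \<eta>
      show ?thesis by (simp add: bad_def)
    qed
    show "\<forall>\<^sub>F n in sequentially. measure_pmf.prob (gnp n p) {E. \<epsilon> < \<bar>X n E / (K * (c n * (real n * sqrt (real n)))) - 1\<bar>}
        \<le> measure_pmf.prob (gnp n p) (bad n) + M n / \<eta>"
      using small c eventually_ge_at_top[of 1]
    proof eventually_elim
      case (elim n)
      define D where "D = c n * (real n * sqrt (real n))"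
      have D: "D > 0" using elim by (simp add: D_def)
      have split: "\<eta> \<le> \<bar>H n E / real n - K\<bar>"
        if E: "E \<subseteq> vertex_pairs n" "E \<notin> bad n" "\<epsilon> < \<bar>X n E / (K * D) - 1\<bar>" for E
      proof (rule ccontr)
        assume "\<not> \<eta> \<le> \<bar>H n E / real n - K\<bar>"
        hence H: "\<bar>H n E / real n - K\<bar> < \<eta>" by simp
        have "\<bar>X n E - c n * sqrt (real n) * H n E\<bar> \<le> 2 * c n * p * real n + real n * sqrt (real n) * (\<eta> * c n)"
          unfolding X_def H_def
          by (rule energy_edge_weights_near_constant) (use E elim p \<eta> sym in \<open>force simp: bad_def\<close>)+
        also have "\<dots> = D * (2 * p / sqrt (real n) + \<eta>)"
          using elim by (simp add: D_def field_simps)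
        finally have 1: "\<bar>X n E - c n * sqrt (real n) * H n E\<bar> \<le> D * (2 * p / sqrt (real n) + \<eta>)" .
        have "c n * sqrt (real n) * H n E - K * D = D * (H n E / real n - K)"
          using elim by (simp add: D_def field_simps)
        hence 2: "\<bar>c n * sqrt (real n) * H n E - K * D\<bar> = D * \<bar>H n E / real n - K\<bar>"
          using D by (simp add: abs_mult)
        have "\<bar>X n E - K * D\<bar> \<le> D * (2 * p / sqrt (real n) + \<eta>) + D * \<bar>H n E / real n - K\<bar>"
          using 1 2 by linarith
        also have "\<dots> = D * (2 * p / sqrt (real n) + \<eta> + \<bar>H n E / real n - K\<bar>)"
          by (simp add: algebra_simps)
        also have "\<dots> \<le> D * (K * \<epsilon>)"
          using D H elim(1) by (intro mult_left_mono) (auto simp: \<eta>_def)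
        finally have "\<bar>X n E - K * D\<bar> / (K * D) \<le> \<epsilon>"
          using K D by (simp add: divide_le_eq mult_ac)
        moreover have "\<bar>X n E / (K * D) - 1\<bar> = \<bar>X n E - K * D\<bar> / (K * D)"
        proof -
          have "X n E / (K * D) - 1 = (X n E - K * D) / (K * D)" using K D by (simp add: diff_divide_distrib)
          thus ?thesis using K D by (simp add: abs_mult)
        qed
        ultimately show False using E(3) by simp
      qed
      have "measure_pmf.prob (gnp n p) {E. \<epsilon> < \<bar>X n E / (K * D) - 1\<bar>} =
          measure_pmf.prob (gnp n p) ({E. \<epsilon> < \<bar>X n E / (K * D) - 1\<bar>} \<inter> set_pmf (gnp n p))"
        by (rule measure_Int_set_pmf[symmetric])
      also have "\<dots> \<le> measure_pmf.prob (gnp n p) (bad n \<union> {E. \<eta> \<le> \<bar>H n E / real n - K\<bar>})"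
        using split set_pmf_gnp_subset[of n p] by (intro measure_pmf.finite_measure_mono) auto
      also have "\<dots> \<le> measure_pmf.prob (gnp n p) (bad n) + measure_pmf.prob (gnp n p) {E. \<eta> \<le> \<bar>H n E / real n - K\<bar>}"
        by (rule measure_Un_le) auto
      also have "measure_pmf.prob (gnp n p) {E. \<eta> \<le> \<bar>H n E / real n - K\<bar>} \<le> M n / \<eta>"
        unfolding M_def using integral_Markov_inequality_measure[of "measure_pmf (gnp n p)" "\<lambda>E. \<bar>H n E / real n - K\<bar>" UNIV \<eta>] \<eta>
        by simp
      finally show ?case by (simp add: D_def)
    qed
  qed auto
qed

lemma prob_tendsto_0_if_degrees_near_mean:
  assumes p: "0 \<le> p" "p \<le> 1" and \<delta>: "\<delta> > 0"
    and good: "\<forall>\<^sub>F n in sequentially. \<forall>E. (\<forall>i\<in>{1..n}. \<bar>real (degree_of E i) - real n * p\<bar> \<le> \<delta> * real n) \<longrightarrow> \<not> B n E"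
  shows "(\<lambda>n. measure_pmf.prob (gnp n p) {E. B n E}) \<longlonglongrightarrow> 0"
proof (rule tendsto_sandwich[OF _ _ tendsto_const all_degrees_concentrated[OF p \<delta>]])
  show "\<forall>\<^sub>F n in sequentially. measure_pmf.prob (gnp n p) {E. B n E} \<le>
     measure_pmf.prob (gnp n p) {E. \<exists>i\<in>{1..n}. \<bar>real (degree_of E i) - real n * p\<bar> > \<delta> * real n}"
    using good
    by eventually_elim (rule measure_pmf.finite_measure_mono, auto simp: not_le[symmetric])
qed auto

text \<open>With \<open>d = n p x\<close> and \<open>x\<close> close to \<open>1\<close>, \<open>ln d\<close> is \<open>ln n\<close> up to a constant that depends on \<open>p\<close> alone, so the
relative error is \<open>O(\<gamma>)\<close> once \<open>ln n\<close> is large compared with that constant.\<close>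

lemma ln_over_id_near_mean:
  fixes p \<gamma> d :: real
  assumes p: "0 < p" and n: "n > 1" and \<gamma>: "0 < \<gamma>" "\<gamma> \<le> 1 / 2"
    and d: "\<bar>d - n * p\<bar> \<le> \<gamma> * p * n"
  shows "\<bar>ln d / d - ln n / (n * p)\<bar> \<le> (2 * \<gamma> * ln n + 2 * (\<bar>ln (p / 2)\<bar> + \<bar>ln (2 * p)\<bar>)) / (n * p)"
proof -
  define x where "x = d / (n * p)"
  have np: "n * p > 0" using n p by simp
  have x: "\<bar>x - 1\<bar> \<le> \<gamma>"
  proof -
    have "d - n * p = (x - 1) * (n * p)" using n p by (simp add: x_def left_diff_distrib)
    hence "\<bar>d - n * p\<bar> = \<bar>x - 1\<bar> * (n * p)" using n p by (simp add: abs_mult)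
    moreover have "\<gamma> * p * n = \<gamma> * (n * p)" by simp
    ultimately have "\<bar>x - 1\<bar> * (n * p) \<le> \<gamma> * (n * p)" using d by (simp only:)
    thus ?thesis using np by (rule mult_right_le_imp_le)
  qed
  hence x_bounds: "1 / 2 \<le> x" "x \<le> 2" using \<gamma> by auto
  have d_eq: "d = n * (p * x)" using n p by (simp add: x_def)
  have ln_d: "ln d = ln n + ln (p * x)"
    unfolding d_eq using n p x_bounds by (subst ln_mult_pos) auto
  have "ln (p / 2) \<le> ln (p * x)" "ln (p * x) \<le> ln (2 * p)"
    using x_bounds p by (auto intro!: ln_mono)
  hence ln_px: "\<bar>ln (p * x)\<bar> \<le> \<bar>ln (p / 2)\<bar> + \<bar>ln (2 * p)\<bar>" by linarith
  have "ln d / d - ln n / (n * p) = ((1 - x) * ln n + ln (p * x)) / x / (n * p)"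
    unfolding ln_d unfolding d_eq using n p x_bounds by (simp add: field_simps)
  hence "\<bar>ln d / d - ln n / (n * p)\<bar> = \<bar>(1 - x) * ln n + ln (p * x)\<bar> / x / (n * p)"
    using n p x_bounds by (simp add: abs_mult)
  also have "\<dots> \<le> (\<gamma> * ln n + (\<bar>ln (p / 2)\<bar> + \<bar>ln (2 * p)\<bar>)) / (1 / 2) / (n * p)"
  proof (intro divide_right_mono frac_le)
    have "\<bar>(1 - x) * ln n + ln (p * x)\<bar> \<le> \<bar>1 - x\<bar> * ln n + \<bar>ln (p * x)\<bar>"
      using n by (intro order.trans[OF abs_triangle_ineq]) (simp add: abs_mult)
    also have "\<dots> \<le> \<gamma> * ln n + (\<bar>ln (p / 2)\<bar> + \<bar>ln (2 * p)\<bar>)"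
      using x ln_px n by (intro add_mono mult_right_mono) auto
    finally show "\<bar>(1 - x) * ln n + ln (p * x)\<bar> \<le> \<gamma> * ln n + (\<bar>ln (p / 2)\<bar> + \<bar>ln (2 * p)\<bar>)" .
  qed (use n np \<gamma> x_bounds in auto)
  finally show ?thesis by (simp add: algebra_simps)
qed

theorem corollary13:
  fixes p :: real
  assumes "0 < p" and "p < 1"
  shows "asymp_almost_all p (\<lambda>n E. energy (first_multiple_Zagreb n E))
           (\<lambda>n. 16 / (3 * pi) * sqrt ((1 - p) / p) * (real n powr (1/2) * ln (real n)))
    \<and> asymp_almost_all p (\<lambda>n E. energy (first_modified_multiple_Zagreb n E))
           (\<lambda>n. 8 / (3 * pi) * sqrt (p * (1 - p)) * (real n powr (3/2) * ln (real n)))"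
proof
  note p = assms
  \<comment> \<open>The part of the error in \<open>ln_over_id_near_mean\<close> that does not grow with \<open>n\<close>.\<close>
  define C where "C = \<bar>ln (p / 2)\<bar> + \<bar>ln (2 * p)\<bar>"
  have ln_large: "\<forall>\<^sub>F n in sequentially. ln (real n) \<ge> x" for x :: real
    using filterlim_compose[OF ln_at_top filterlim_real_sequentially] by (auto simp: filterlim_at_top)
  have root: "real n powr (1/2) = sqrt (real n)" for n by (rule powr_half_sqrt) simp
  have "asymp_almost_all p (\<lambda>n E. energy (first_multiple_Zagreb n E))
     (\<lambda>n. 8 / (3 * pi) * sqrt (p * (1 - p)) * (2 * ln (real n) / (real n * p) * (real n * sqrt (real n))))"
    unfolding first_multiple_Zagreb_def
  proof (rule energy_edge_weights_asymptotics[OF p])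
    show "\<forall>\<^sub>F n in sequentially. 0 < 2 * ln (real n) / (real n * p)"
      using eventually_gt_at_top[of 1] by eventually_elim (use p in simp)
    fix \<eta> :: real assume \<eta>: "\<eta> > 0"
    define \<gamma> where "\<gamma> = min (1 / 2) (\<eta> / 4)"
    have \<gamma>: "0 < \<gamma>" "\<gamma> \<le> 1 / 2" "\<gamma> \<le> \<eta> / 4" using \<eta> by (auto simp: \<gamma>_def)
    show "(\<lambda>n. measure_pmf.prob (gnp n p) {E. \<exists>i\<in>{1..n}. \<exists>j\<in>{1..n}. {i, j} \<in> E \<and>
        \<eta> * (2 * ln (real n) / (real n * p)) < \<bar>ln (real (degree_of E i)) / real (degree_of E i) +
           ln (real (degree_of E j)) / real (degree_of E j) - 2 * ln (real n) / (real n * p)\<bar>}) \<longlonglongrightarrow> 0"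
    proof (rule prob_tendsto_0_if_degrees_near_mean[of _ "\<gamma> * p"])
      show "\<forall>\<^sub>F n in sequentially. \<forall>E. (\<forall>i\<in>{1..n}. \<bar>real (degree_of E i) - real n * p\<bar> \<le> \<gamma> * p * real n) \<longrightarrow>
        \<not> (\<exists>i\<in>{1..n}. \<exists>j\<in>{1..n}. {i, j} \<in> E \<and>
        \<eta> * (2 * ln (real n) / (real n * p)) < \<bar>ln (real (degree_of E i)) / real (degree_of E i) +
           ln (real (degree_of E j)) / real (degree_of E j) - 2 * ln (real n) / (real n * p)\<bar>)"
        using eventually_gt_at_top[of 1] ln_large[of "4 * C / \<eta>"]
      proof eventually_elim
        case (elim n)
        have np: "real n * p > 0" using elim p by simp
        have single: "\<bar>ln d / d - ln (real n) / (real n * p)\<bar> \<le> \<eta> * (ln (real n) / (real n * p))"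
          if "\<bar>d - real n * p\<bar> \<le> \<gamma> * p * real n" for d
        proof -
          have "\<bar>ln d / d - ln (real n) / (real n * p)\<bar> \<le> (2 * \<gamma> * ln (real n) + 2 * C) / (real n * p)"
            unfolding C_def by (rule ln_over_id_near_mean) (use p \<gamma> elim that in auto)
          also have "\<dots> \<le> (\<eta> * ln (real n)) / (real n * p)"
          proof (rule divide_right_mono)
            have "2 * \<gamma> * ln (real n) \<le> \<eta> / 2 * ln (real n)"
              using \<gamma> elim by (intro mult_right_mono) auto
            moreover have "2 * C \<le> \<eta> / 2 * ln (real n)"
              using elim(2) \<eta> by (simp add: field_simps)
            ultimately show "2 * \<gamma> * ln (real n) + 2 * C \<le> \<eta> * ln (real n)"
              by (simp add: field_simps)
          qed (use np in simp)
          finally show ?thesis by simp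
        qed
        show ?case
        proof (intro allI impI notI)
          fix E
          assume deg: "\<forall>i\<in>{1..n}. \<bar>real (degree_of E i) - real n * p\<bar> \<le> \<gamma> * p * real n"
          assume "\<exists>i\<in>{1..n}. \<exists>j\<in>{1..n}. {i, j} \<in> E \<and>
            \<eta> * (2 * ln (real n) / (real n * p)) < \<bar>ln (real (degree_of E i)) / real (degree_of E i) +
             ln (real (degree_of E j)) / real (degree_of E j) - 2 * ln (real n) / (real n * p)\<bar>"
          then obtain i j where ij: "i \<in> {1..n}" "j \<in> {1..n}" and
            far: "\<eta> * (2 * ln (real n) / (real n * p)) < \<bar>ln (real (degree_of E i)) / real (degree_of E i) +
             ln (real (degree_of E j)) / real (degree_of E j) - 2 * ln (real n) / (real n * p)\<bar>" by blast
          have twice: "2 * ln (real n) / (real n * p) = ln (real n) / (real n * p) + ln (real n) / (real n * p)"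
            by simp
          have "\<bar>x + y - (m + m)\<bar> \<le> e + e" if "\<bar>x - m\<bar> \<le> e" "\<bar>y - m\<bar> \<le> e" for x y m e :: real
            using that by linarith
          from this[OF single[OF bspec[OF deg ij(1)]] single[OF bspec[OF deg ij(2)]]] far
          show False unfolding twice distrib_left by simp
        qed
      qed
    qed (use p \<gamma> in auto)
  qed (simp add: add.commute)
  also have "(\<lambda>n. 8 / (3 * pi) * sqrt (p * (1 - p)) * (2 * ln (real n) / (real n * p) * (real n * sqrt (real n)))) =
     (\<lambda>n. 16 / (3 * pi) * sqrt ((1 - p) / p) * (real n powr (1/2) * ln (real n)))"
  proof
    fix n
    have "(1 - p) / p = p * (1 - p) / (p * p)" using p by simp
    hence "sqrt ((1 - p) / p) = sqrt (p * (1 - p)) / sqrt (p * p)" by (simp only: real_sqrt_divide)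
    also have "sqrt (p * p) = p" using p by simp
    finally have eq: "sqrt ((1 - p) / p) = sqrt (p * (1 - p)) / p" .
    show "8 / (3 * pi) * sqrt (p * (1 - p)) * (2 * ln (real n) / (real n * p) * (real n * sqrt (real n))) =
       16 / (3 * pi) * sqrt ((1 - p) / p) * (real n powr (1/2) * ln (real n))"
      unfolding eq root by (cases "n = 0") (use p in \<open>simp_all add: field_simps\<close>)
  qed
  finally show "asymp_almost_all p (\<lambda>n E. energy (first_multiple_Zagreb n E))
     (\<lambda>n. 16 / (3 * pi) * sqrt ((1 - p) / p) * (real n powr (1/2) * ln (real n)))" .
  have "asymp_almost_all p (\<lambda>n E. energy (first_modified_multiple_Zagreb n E))
     (\<lambda>n. 8 / (3 * pi) * sqrt (p * (1 - p)) * (ln (real n) * (real n * sqrt (real n))))"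
    unfolding first_modified_multiple_Zagreb_def
  proof (rule energy_edge_weights_asymptotics[OF p])
    show "\<forall>\<^sub>F n in sequentially. 0 < ln (real n)"
      using eventually_gt_at_top[of 1] by eventually_elim simp
    fix \<eta> :: real assume \<eta>: "\<eta> > 0"
    \<comment> \<open>The sum of two degrees lies between \<open>p n\<close> and \<open>3 p n\<close>, so its logarithm is within \<open>C'\<close> of \<open>ln n\<close>.
      Already a fixed relative error of the degrees suffices here, since \<open>C'\<close> is negligible against \<open>ln n\<close>.\<close>
    define C' where "C' = \<bar>ln p\<bar> + \<bar>ln (3 * p)\<bar>"
    show "(\<lambda>n. measure_pmf.prob (gnp n p) {E. \<exists>i\<in>{1..n}. \<exists>j\<in>{1..n}. {i, j} \<in> E \<and>
        \<eta> * ln (real n) < \<bar>ln (real (degree_of E i) + real (degree_of E j)) - ln (real n)\<bar>}) \<longlonglongrightarrow> 0"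
    proof (rule prob_tendsto_0_if_degrees_near_mean[of _ "p / 2"])
      show "\<forall>\<^sub>F n in sequentially. \<forall>E. (\<forall>i\<in>{1..n}. \<bar>real (degree_of E i) - real n * p\<bar> \<le> p / 2 * real n) \<longrightarrow>
        \<not> (\<exists>i\<in>{1..n}. \<exists>j\<in>{1..n}. {i, j} \<in> E \<and>
        \<eta> * ln (real n) < \<bar>ln (real (degree_of E i) + real (degree_of E j)) - ln (real n)\<bar>)"
        using eventually_gt_at_top[of 1] ln_large[of "C' / \<eta>"]
      proof eventually_elim
        case (elim n)
        show ?case
        proof (intro allI impI notI)
          fix E
          assume deg: "\<forall>i\<in>{1..n}. \<bar>real (degree_of E i) - real n * p\<bar> \<le> p / 2 * real n"
          assume "\<exists>i\<in>{1..n}. \<exists>j\<in>{1..n}. {i, j} \<in> E \<and>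
            \<eta> * ln (real n) < \<bar>ln (real (degree_of E i) + real (degree_of E j)) - ln (real n)\<bar>"
          then obtain i j where ij: "i \<in> {1..n}" "j \<in> {1..n}" and
            far: "\<eta> * ln (real n) < \<bar>ln (real (degree_of E i) + real (degree_of E j)) - ln (real n)\<bar>" by blast
          define s where "s = real (degree_of E i) + real (degree_of E j)"
          have "p * real n \<le> s" "s \<le> 3 * p * real n"
            using bspec[OF deg ij(1)] bspec[OF deg ij(2)] unfolding s_def abs_le_iff
            by (simp_all add: field_simps)
          moreover have "0 < p * real n" using p elim by simp
          ultimately have "ln (p * real n) \<le> ln s" "ln s \<le> ln (3 * p * real n)"
            by (auto intro!: ln_mono)
          moreover have "ln (p * real n) = ln p + ln (real n)" "ln (3 * p * real n) = ln (3 * p) + ln (real n)"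
            using p elim by (auto intro!: ln_mult_pos)
          ultimately have "\<bar>ln s - ln (real n)\<bar> \<le> C'" unfolding C'_def by linarith
          moreover have "C' \<le> \<eta> * ln (real n)" using elim(2) \<eta> by (simp add: field_simps)
          ultimately show False using far by (simp add: s_def)
        qed
      qed
    qed (use p in auto)
  qed (simp add: add.commute)
  also have "(\<lambda>n. 8 / (3 * pi) * sqrt (p * (1 - p)) * (ln (real n) * (real n * sqrt (real n)))) =
     (\<lambda>n. 8 / (3 * pi) * sqrt (p * (1 - p)) * (real n powr (3/2) * ln (real n)))"
  proof
    fix n
    have "real n powr (3/2) = real n powr 1 * real n powr (1/2)"
      by (subst powr_add[symmetric]) simp
    thus "8 / (3 * pi) * sqrt (p * (1 - p)) * (ln (real n) * (real n * sqrt (real n))) =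
      8 / (3 * pi) * sqrt (p * (1 - p)) * (real n powr (3/2) * ln (real n))"
      by (simp add: root)
  qed
  finally show "asymp_almost_all p (\<lambda>n E. energy (first_modified_multiple_Zagreb n E))
     (\<lambda>n. 8 / (3 * pi) * sqrt (p * (1 - p)) * (real n powr (3/2) * ln (real n)))" .
qed

end
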